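(* Let $T>0$, let $b:[0,T]\times\mathbb{R}^d\to\mathbb{R}^d$ be measurable, and suppose there are nonnegative $C_0,C_1\in L^1([0,T])$ such that for all $t\in[0,T]$ and $x,y\in\mathbb{R}^d$, $|b(t,x)|\le C_0(t)(1+|x|)$ and $(b(t,x)-b(t,y))\cdot(x-y)\ge -C_1(t)|x-y|^2$. For any $1\le p\le\infty$ and $f_0\in L^p_{\mathrm{loc}}(\mathbb{R}^d)$, the good solution $f$ of $$\partial_tf+\operatorname{div}(b(t,x)f)=0\ \text{ in }(0,T)\times\mathbb{R}^d,\qquad f(0,\cdot)=f_0$$ is given at each time $t>0$ by the pushforward $f(t,\cdot)=(\phi_{t,0})^{\#}f_0$ of $f_0$ by the forward flow $\phi_{t,0}$ of $b$.
   Context: Backward Filippov flow: let $\hat b(t,x)$ be the convex hull of all limit points of $b(t,y)$ as $y\to x$. For every $(s,x)$ there is a unique absolutely continuous $[0,s]\ni t\mapsto\phi_{t,s}(x)$ with $\partial_t\phi_{t,s}(x)\in\hat b(t,\phi_{t,s}(x))$ for a.e. $t$ and $\phi_{s,s}(x)=x$; it is Lipschitz in $x$. Set $J_{t,s}(x)=\det(\nabla_x\phi_{t,s}(x))$ for a.e. $x$, $t\le s$. Good solution: $f(t,x)=f_0(\phi_{0,t}(x))J_{0,t}(x)$ (zero where $J_{0,t}=0$). Forward flow: for $0\le s\le t\le T$ and a.e. $y$, $\phi_{s,t}^{-1}(\{y\})$ is a singleton, whose element is denoted $\phi_{t,s}(y)$; $\phi_{t,s}$ denotes a version of this right inverse that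 is continuous almost everywhere. Functions in $L^p_{\mathrm{loc}}$ are identified with the (signed, locally finite) measures of which they are the densities. *)

theory Defs
  imports "HOL-Analysis.Analysis"
begin

(* Absolute continuity of a curve on the interval [a,b]. The members of a division are nonempty
   compact intervals with pairwise disjoint interiors, and each K is [Inf K, Sup K]. *)
definition abs_continuous_curve :: "real \<Rightarrow> real \<Rightarrow> (real \<Rightarrow> 'a::real_normed_vector) \<Rightarrow> bool" where
  "abs_continuous_curve a b \<gamma> \<longleftrightarrow>
     (\<forall>\<epsilon>>0. \<exists>\<delta>>0. \<forall>D S. D division_of S \<and> S \<subseteq> {a..b} \<and> (\<Sum>K\<in>D. Sup K - Inf K) < \<delta>
        \<longrightarrow> (\<Sum>K\<in>D. norm (\<gamma> (Sup K) - \<gamma> (Inf K))) < \<epsilon>)"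

definition filippov_hull ::
    "(real \<Rightarrow> 'a::real_normed_vector \<Rightarrow> 'a) \<Rightarrow> real \<Rightarrow> 'a \<Rightarrow> 'a set" where
  "filippov_hull b t x =
     convex hull {z. \<exists>y. filterlim y (at x) sequentially \<and> (\<lambda>n. b t (y n)) \<longlonglongrightarrow> z}"

definition backward_filippov_trajectory ::
    "(real \<Rightarrow> 'a::real_normed_vector \<Rightarrow> 'a) \<Rightarrow> real \<Rightarrow> 'a \<Rightarrow> (real \<Rightarrow> 'a) \<Rightarrow> bool" where
  "backward_filippov_trajectory b s x \<gamma> \<longleftrightarrow>
     abs_continuous_curve 0 s \<gamma> \<and> \<gamma> s = x \<and>
     (AE t in lebesgue. t \<in> {0..s} \<longrightarrow>
        (\<exists>v \<in> filippov_hull b t (\<gamma> t). (\<gamma> has_vector_derivative v) (at t within {0..s})))"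

(* Convention: \<phi> t s x is the position at time t of the trajectory that is at x at time s.
   Only its values for 0 \<le> t \<le> s \<le> T are constrained. *)
definition backward_flow ::
    "real \<Rightarrow> (real \<Rightarrow> 'a::real_normed_vector \<Rightarrow> 'a) \<Rightarrow> (real \<Rightarrow> real \<Rightarrow> 'a \<Rightarrow> 'a) \<Rightarrow> bool" where
  "backward_flow T b \<phi> \<longleftrightarrow>
     (\<forall>s\<in>{0..T}. \<forall>x. backward_filippov_trajectory b s x (\<lambda>t. \<phi> t s x))"

(* \<psi> t s, for s \<le> t, is an almost everywhere continuous version of the right inverse of
   the backward map \<phi> s t. *)
definition forward_flow ::
    "real \<Rightarrow> (real \<Rightarrow> real \<Rightarrow> 'a::euclidean_space \<Rightarrow> 'a) \<Rightarrow> (real \<Rightarrow> real \<Rightarrow> 'a \<Rightarrow> 'a) \<Rightarrow> bool" where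
  "forward_flow T \<phi> \<psi> \<longleftrightarrow>
     (\<forall>s t. 0 \<le> s \<and> s \<le> t \<and> t \<le> T \<longrightarrow>
        (AE y in lebesgue. \<phi> s t -` {y} = {\<psi> t s y}) \<and>
        (AE y in lebesgue. isCont (\<psi> t s) y))"

(* The value at points of non-differentiability is irrelevant: \<phi> t s is Lipschitz, so these
   points form a null set. *)
definition flow_jacobian ::
    "(real \<Rightarrow> real \<Rightarrow> real^'n \<Rightarrow> real^'n) \<Rightarrow> real \<Rightarrow> real \<Rightarrow> real^'n \<Rightarrow> real" where
  "flow_jacobian \<phi> t s x = det (jacobian (\<phi> t s) (at x))"

definition good_solution ::
    "(real \<Rightarrow> real \<Rightarrow> real^'n \<Rightarrow> real^'n) \<Rightarrow> (real^'n \<Rightarrow> real) \<Rightarrow> real \<Rightarrow> real^'n \<Rightarrow> real" where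
  "good_solution \<phi> f\<^sub>0 t x = f\<^sub>0 (\<phi> 0 t x) * flow_jacobian \<phi> 0 t x"

(* Membership in the local Lebesgue space for 1 \<le> p \<le> \<infinity>; for p = \<infinity> this is local essential
   boundedness. *)
definition Lp_loc :: "ennreal \<Rightarrow> ('a::euclidean_space \<Rightarrow> real) \<Rightarrow> bool" where
  "Lp_loc p f \<longleftrightarrow> f \<in> borel_measurable lebesgue \<and>
     (\<forall>K. compact K \<longrightarrow>
        (if p = \<infinity> then \<exists>M. AE x in lebesgue. x \<in> K \<longrightarrow> \<bar>f x\<bar> \<le> M
         else set_integrable lebesgue K (\<lambda>x. \<bar>f x\<bar> powr enn2real p)))"

(* The signed, locally finite measure with Lebesgue density g is the pushforward under \<psi> of the
   one with density f. Such measures are defined on bounded Borel sets only, the total variation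
   possibly being infinite. *)
definition pushforward_density ::
    "('a::euclidean_space \<Rightarrow> 'a) \<Rightarrow> ('a \<Rightarrow> real) \<Rightarrow> ('a \<Rightarrow> real) \<Rightarrow> bool" where
  "pushforward_density \<psi> f g \<longleftrightarrow>
     \<psi> \<in> lebesgue \<rightarrow>\<^sub>M borel \<and>
     (\<forall>A \<in> sets borel. bounded A \<longrightarrow>
        set_integrable lebesgue (\<psi> -` A) f \<and> set_integrable lebesgue A g \<and>
        (LINT x:A|lebesgue. g x) = (LINT y:\<psi> -` A|lebesgue. f y))"

end

theory Submission
  imports Defs "HOL-Homology.Homology"
begin

text \<open>Write $\Phi = \phi_{0,t}$. The one-sided Lipschitz bound passes to the Filippov hull, so the squared
  distance $u$ of two trajectories satisfies $u' \ge -2 C_1 u$ almost everywhere; integrating the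
  derivative of $\ln (u + \varepsilon)$ shows that $|\phi_{r,t}(x) - \phi_{r,t}(y)| \le
  L\, |\phi_{s,t}(x) - \phi_{s,t}(y)|$ for $r \le s \le t$. In particular $\Phi$ is Lipschitz, hence
  differentiable almost everywhere by Rademacher's theorem.

  The Jacobian is nonnegative: where $D\Phi(x_0)$ is invertible, the estimate with $r = 0$ shows that
  $\phi_{s,t}(x_0 + \rho u) - \phi_{s,t}(x_0)$ vanishes for no $s \in [0,t]$ and unit vector $u$, if
  $\rho$ is small. Letting $s$ run from $t$ to $0$ gives a homotopy in $\mathbb{R}^d \setminus \{0\}$ from the
  inclusion of the sphere to $D\Phi(x_0)$, whose Brouwer degree, the sign of its determinant, is thus $1$.

  The pushforward formula is then the change of variables $y = \Phi(x)$ on the set where $\Phi$ is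
  differentiable with nonzero Jacobian and $\Phi(x)$ has a singleton fibre. Sard's lemma and the
  local invertibility of $\Phi$ at points of nonzero Jacobian make the discarded sets negligible.\<close>

subsection \<open>Rademacher's theorem\<close>

text \<open>The one-sided bound controls trajectories backwards in time only: as time decreases they
  may merge, but once merged they stay together down to time 0. Hence \<Phi> is Lipschitz but in
  general not injective, and the change of variables has to be confined to points whose image has a
  singleton fibre. The same fact drives the homotopy: separation at time 0 forces separation at
  every s in [0,t].

  The constant L is the exponential of the integral of \<open>C\<^sub>1\<close> over [0,t]; the rate
  2 \<open>C\<^sub>1\<close> for the squared distance becomes \<open>C\<^sub>1\<close> after the
  square root. The shift by \<epsilon> is there because u may vanish, and the resulting bound lets
  \<epsilon> tend to 0.

  The good solution carries the determinant itself, whereas the change of variables produces its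
  absolute value, so the sign has to be settled. The intermediate flow maps are merely Lipschitz: at
  a given point their determinants need not exist and cannot be followed from time t to time 0. The
  degree needs only continuity in between.\<close>

lemma indefinite_integral_right_derivative:
  fixes F h :: "real \<Rightarrow> real"
  assumes int: "\<And>a b. h integrable_on {a..b}"
    and F: "\<And>a b. a \<le> b \<Longrightarrow> F b - F a = integral {a..b} h"
  shows "AE x in lborel. ((\<lambda>k. (F (x + k) - F x) / k) \<longlongrightarrow> h x) (at_right 0)"
proof -
  \<comment> \<open>The averages run over cubes with lower corner x, so on the line only the
    derivative from the right comes out. Quotients therefore stay one-sided until full
    differentiability is assembled.\<close>
  obtain N where N: "negligible N"
    and lim: "\<And>x e. \<lbrakk>x \<notin> N; 0 < e\<rbrakk> \<Longrightarrow>
      \<exists>d>0. \<forall>k. 0 < k \<and> k < d \<longrightarrow> norm (integral (cbox x (x + k *\<^sub>R One)) h /\<^sub>R k ^ DIM(real) - h x) < e"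
    by (rule integrable_ccontinuous_explicit[of h]) (use int in auto)
  have "((\<lambda>k. (F (x + k) - F x) / k) \<longlongrightarrow> h x) (at_right 0)" if "x \<notin> N" for x
  proof (rule tendstoI)
    fix e :: real assume "e > 0"
    from lim[OF that this] obtain d where d: "d > 0"
      "\<And>k. 0 < k \<Longrightarrow> k < d \<Longrightarrow> norm (integral (cbox x (x + k *\<^sub>R One)) h /\<^sub>R k ^ DIM(real) - h x) < e"
      by blast
    have "dist ((F (x + k) - F x) / k) (h x) < e" if k: "0 < k" "k < d" for k
      using d(2)[OF k] F[of x "x + k"] k by (simp add: dist_norm divide_inverse mult.commute)
    then show "\<forall>\<^sub>F k in at_right 0. dist ((F (x + k) - F x) / k) (h x) < e"
      using \<open>d > 0\<close> by (auto simp: eventually_at_right_field)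
  qed
  then have "AE x in lebesgue. ((\<lambda>k. (F (x + k) - F x) / k) \<longlongrightarrow> h x) (at_right 0)"
    using N by (intro AE_I'[of N]) (auto simp: negligible_iff_null_sets)
  then show ?thesis by (simp add: AE_completion_iff)
qed

text \<open>Since $F$ maps null sets to null sets, the pushforward of Lebesgue measure under $F^{-1}$, which has
  distribution function $F$, is absolutely continuous; its density is the derivative of $F$.\<close>
lemma expanding_Lipschitz_right_derivative:
  fixes F :: "real \<Rightarrow> real"
  assumes low: "\<And>x y. x \<le> y \<Longrightarrow> y - x \<le> F y - F x"
    and Lip: "\<And>x y. \<bar>F y - F x\<bar> \<le> B * \<bar>y - x\<bar>"
  shows "AE x in lborel. \<exists>l. ((\<lambda>k. (F (x + k) - F x) / k) \<longlongrightarrow> l) (at_right 0)"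
proof -
  have le: "F x \<le> F y \<longleftrightarrow> x \<le> y" for x y
    using low[of x y] low[of y x] by linarith
  have inj: "inj F" by (rule injI) (use le in \<open>metis order.antisym order.refl\<close>)
  have cont: "continuous_on UNIV F"
  proof -
    have "B-lipschitz_on UNIV F"
      using Lip[of 0 1] by (intro lipschitz_onI) (auto simp: dist_real_def intro: Lip)
    then show ?thesis by (rule lipschitz_on_continuous_on)
  qed
  have surj: "surj F"
  proof -
    have "\<exists>x. F x = y" for y
    proof -
      have "F (- \<bar>y - F 0\<bar>) \<le> y" "y \<le> F \<bar>y - F 0\<bar>"
        using low[of "- \<bar>y - F 0\<bar>" 0] low[of 0 "\<bar>y - F 0\<bar>"] by linarith+
      then show ?thesis
        using IVT'[of F "- \<bar>y - F 0\<bar>" y "\<bar>y - F 0\<bar>"] cont continuous_on_subset by force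
    qed
    then show ?thesis by (metis surjI)
  qed
  define G where "G = inv_into UNIV F"
  have FG [simp]: "F (G y) = y" "G (F x) = x" for x y
    by (simp_all add: G_def inj surj surj_f_inv_f)
  have G_le: "G x \<le> G y \<longleftrightarrow> x \<le> y" for x y using le[of "G x" "G y"] by simp
  have Gm [measurable]: "G \<in> borel_measurable borel"
    by (rule borel_measurable_mono) (simp add: G_le mono_def)
  define M where "M = distr lborel borel G"
  have vim: "G -` A = F ` A" for A by (auto simp: image_iff) (metis FG(1))
  have M_Ioc: "emeasure M {a<..b} = ennreal (F b - F a)" if "a \<le> b" for a b
  proof -
    have "x < G y \<longleftrightarrow> F x < y" "G y \<le> x \<longleftrightarrow> y \<le> F x" for x y
      by (metis FG(2) G_le not_le)+
    then have "G -` {a<..b} = {F a<..F b}"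
      by auto
    then show ?thesis using that le by (simp add: M_def emeasure_distr)
  qed
  have "absolutely_continuous lborel M"
    unfolding absolutely_continuous_def
  proof
    fix A assume A: "A \<in> null_sets (lborel::real measure)"
    then have [measurable]: "A \<in> sets borel" by auto
    have "negligible A" using A by (simp add: negligible_iff_null_sets null_sets_completionI)
    then have "negligible (F ` A)"
      by (rule negligible_locally_Lipschitz_image[rotated]) (auto intro!: exI[of _ UNIV] exI[of _ B] Lip)
    then have "F ` A \<in> null_sets lebesgue" by (simp add: negligible_iff_null_sets)
    moreover have "F ` A \<in> sets borel" using measurable_sets[OF Gm, of A] by (simp add: vim)
    ultimately have "emeasure lborel (F ` A) = 0"
      by (simp add: null_sets_completion_iff null_setsD1)
    then show "A \<in> null_sets M"
      by (auto simp: null_sets_def M_def emeasure_distr vim)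
  qed
  then obtain h where h [measurable]: "h \<in> borel_measurable lborel" and hM: "density lborel h = M"
    using sigma_finite_measure.Radon_Nikodym[OF sigma_finite_lborel, of M] by (auto simp: M_def)
  have nnh: "(\<integral>\<^sup>+x\<in>{a<..b}. h x \<partial>lborel) = ennreal (F b - F a)" if "a \<le> b" for a b
    using M_Ioc[OF that] by (simp add: hM[symmetric] emeasure_density)
  \<comment> \<open>The Radon-Nikodym density takes extended values; infinite ones are excluded on
    each bounded interval, where its integral is finite.\<close>
  have fin: "AE x in lborel. h x < \<infinity>"
  proof -
    have "AE x in lborel. x \<in> {- real n<..real n} \<longrightarrow> h x < \<infinity>" for n
    proof -
      have "AE x in lborel. h x * indicator {- real n<..real n} x \<noteq> \<infinity>"
        by (rule nn_integral_PInf_AE) (simp_all add: nnh)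
      then show ?thesis by eventually_elim (auto simp: indicator_def top.not_eq_extremum)
    qed
    then have "AE x in lborel. \<forall>n. x \<in> {- real n<..real n} \<longrightarrow> h x < \<infinity>"
      by (subst AE_all_countable) blast
    moreover have "\<exists>n. x \<in> {- real n<..real n}" for x :: real
      proof -
      obtain n where "\<bar>x\<bar> < real n" using reals_Archimedean2 by blast
      then show ?thesis by (intro exI[of _ n]) auto
    qed
    ultimately show ?thesis by (auto elim!: eventually_mono)
  qed
  define g where "g = (\<lambda>x. enn2real (h x))"
  have [measurable]: "g \<in> borel_measurable borel" unfolding g_def by measurable
  have hb: "has_bochner_integral lborel (\<lambda>x. indicator {a<..b} x *\<^sub>R g x) (F b - F a)" if "a \<le> b" for a b
  proof (rule has_bochner_integral_nn_integral)
    have "(\<integral>\<^sup>+x. ennreal (indicator {a<..b} x *\<^sub>R g x) \<partial>lborel) = (\<integral>\<^sup>+x\<in>{a<..b}. h x \<partial>lborel)"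
      using fin by (intro nn_integral_cong_AE, eventually_elim) (auto simp: g_def indicator_def)
    then show "(\<integral>\<^sup>+x. ennreal (indicator {a<..b} x *\<^sub>R g x) \<partial>lborel) = ennreal (F b - F a)"
      using nnh[OF that] by simp
  qed (use that low[of a b] in \<open>auto simp: g_def\<close>)
  have hi: "(g has_integral (F b - F a)) {a..b}" if "a \<le> b" for a b
  proof -
    have "set_integrable lborel {a<..b} g" "(LINT x:{a<..b}|lborel. g x) = F b - F a"
      using hb[OF that] by (auto simp: set_integrable_def set_lebesgue_integral_def has_bochner_integral_iff)
    then have "(g has_integral (F b - F a)) {a<..b}"
      using set_borel_integral_eq_integral[of "{a<..b}" g] by (simp add: has_integral_iff)
    then show ?thesis
      by (rule has_integral_spike_set_eq[THEN iffD1, rotated 2]) (rule negligible_subset[of "{a}"]; auto)+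
  qed
  have "AE x in lborel. ((\<lambda>k. (F (x + k) - F x) / k) \<longlongrightarrow> g x) (at_right 0)"
  proof (rule indefinite_integral_right_derivative)
    show "g integrable_on {a..b}" for a b
      using hi[of a b] by (cases "a \<le> b") (auto simp: integrable_on_def)
    show "F b - F a = integral {a..b} g" if "a \<le> b" for a b
      using hi[OF that] by (simp add: integral_unique)
  qed
  then show ?thesis by (auto elim!: eventually_mono)
qed

text \<open>The linear term \<open>(B + 1) * x\<close> outweighs the steepest possible descent and
  leaves slope at least 1, so the expanding case applies. It changes every difference quotient by
  the constant \<open>B + 1\<close> only.\<close>

lemma Lipschitz_real_right_derivative:
  fixes f :: "real \<Rightarrow> real"
  assumes Lip: "\<And>x y. \<bar>f y - f x\<bar> \<le> B * \<bar>y - x\<bar>"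
  shows "AE x in lborel. \<exists>l. ((\<lambda>k. (f (x + k) - f x) / k) \<longlongrightarrow> l) (at_right 0)"
proof -
  define F where "F x = f x + (B + 1) * x" for x
  have B: "B \<ge> 0" using Lip[of 0 1] by simp
  have "AE x in lborel. \<exists>l. ((\<lambda>k. (F (x + k) - F x) / k) \<longlongrightarrow> l) (at_right 0)"
  proof (rule expanding_Lipschitz_right_derivative)
    show "y - x \<le> F y - F x" if "x \<le> y" for x y
      using Lip[of y x] that by (simp add: F_def abs_if algebra_simps split: if_splits)
    show "\<bar>F y - F x\<bar> \<le> (2 * B + 1) * \<bar>y - x\<bar>" for x y
    proof -
      have "F y - F x = (f y - f x) + (B + 1) * (y - x)" by (simp add: F_def algebra_simps)
      then have "\<bar>F y - F x\<bar> \<le> \<bar>f y - f x\<bar> + \<bar>(B + 1) * (y - x)\<bar>" by (metis abs_triangle_ineq)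
      also have "\<dots> \<le> B * \<bar>y - x\<bar> + (B + 1) * \<bar>y - x\<bar>" using Lip[of y x] B by (simp add: abs_mult)
      finally show ?thesis by (simp add: algebra_simps)
    qed
  qed
  then show ?thesis
  proof eventually_elim
    case (elim x)
    then obtain l where l: "((\<lambda>k. (F (x + k) - F x) / k) \<longlongrightarrow> l) (at_right 0)" by blast
    have "((\<lambda>k. (F (x + k) - F x) / k - (B + 1)) \<longlongrightarrow> l - (B + 1)) (at_right 0)"
      by (intro tendsto_intros l)
    moreover have "\<forall>\<^sub>F k in at_right 0. (F (x + k) - F x) / k - (B + 1) = (f (x + k) - f x) / k"
      using eventually_at_right_less[of 0]
    proof eventually_elim
      case (elim k)
      have "F (x + k) - F x = f (x + k) - f x + (B + 1) * k" by (simp add: F_def algebra_simps)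
      then show ?case using elim by (simp add: add_divide_distrib)
    qed
    ultimately have "((\<lambda>k. (f (x + k) - f x) / k) \<longlongrightarrow> l - (B + 1)) (at_right 0)"
      by (rule Lim_transform_eventually)
    then show ?case ..
  qed
qed

text \<open>Serves measurability in a parameter: the right side is a countable combination of
  conditions at rational increments. It is the Cauchy criterion, and continuity of q carries the
  bound from rational to real increments.\<close>

lemma convergent_at_right_iff_Cauchy_Rats:
  fixes q :: "real \<Rightarrow> real"
  assumes "continuous_on {0<..} q"
  shows "(\<exists>l. (q \<longlongrightarrow> l) (at_right 0)) \<longleftrightarrow>
    (\<forall>n. \<exists>m. \<forall>h\<in>\<rat>. \<forall>k\<in>\<rat>. 0 < h \<and> h < inverse (Suc m) \<and> 0 < k \<and> k < inverse (Suc m) \<longrightarrow>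
       \<bar>q h - q k\<bar> \<le> inverse (Suc n))" (is "_ \<longleftrightarrow> (\<forall>n. \<exists>m. ?P n m)")
proof
  assume "\<exists>l. (q \<longlongrightarrow> l) (at_right 0)"
  then obtain l where l: "(q \<longlongrightarrow> l) (at_right 0)" by blast
  show "\<forall>n. \<exists>m. ?P n m"
  proof
    fix n
    have "\<forall>\<^sub>F h in at_right 0. dist (q h) l < inverse (Suc n) / 2"
      by (rule tendstoD[OF l]) simp
    then obtain b where b: "b > 0" "\<And>h. 0 < h \<Longrightarrow> h < b \<Longrightarrow> dist (q h) l < inverse (Suc n) / 2"
      by (auto simp: eventually_at_right_field)
    obtain m where m: "inverse (real (Suc m)) < b" using reals_Archimedean[OF b(1)] by blast
    have "\<bar>q h - q k\<bar> \<le> inverse (Suc n)"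
      if "0 < h" "h < inverse (Suc m)" "0 < k" "k < inverse (Suc m)" for h k
      using b(2)[of h] b(2)[of k] that m unfolding dist_real_def by linarith
    then show "\<exists>m. ?P n m" by blast
  qed
next
  assume R: "\<forall>n. \<exists>m. ?P n m"
  have *: "\<exists>m. \<forall>h k. 0 < h \<and> h < inverse (Suc m) \<and> 0 < k \<and> k < inverse (Suc m) \<longrightarrow>
       \<bar>q h - q k\<bar> \<le> inverse (Suc n)" for n
  proof -
    obtain m where m: "?P n m" using R by blast
    define I where "I = {0<..<inverse (real (Suc m))}"
    have dense: "I \<times> I \<subseteq> closure ((I \<inter> \<rat>) \<times> (I \<inter> \<rat>))"
    proof -
      have "I \<subseteq> closure (I \<inter> \<rat>)"
        using open_Int_closure_subset[of I "\<rat>"] by (simp add: I_def Rats_closure_real)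
      then show ?thesis by (auto simp: closure_Times)
    qed
    have cont: "continuous_on (I \<times> I) (\<lambda>z. \<bar>q (fst z) - q (snd z)\<bar>)"
      by (intro continuous_intros continuous_on_compose2[OF assms]) (auto simp: I_def)
    have "\<bar>q (fst z) - q (snd z)\<bar> \<le> inverse (Suc n)" if z: "z \<in> I \<times> I" for z
    proof -
      have "z \<in> closure ((I \<inter> \<rat>) \<times> (I \<inter> \<rat>))" using dense z by blast
      then obtain s where s: "\<And>i. s i \<in> (I \<inter> \<rat>) \<times> (I \<inter> \<rat>)" "s \<longlonglongrightarrow> z"
        by (auto simp: closure_sequential)
      have "s i \<in> I \<times> I" for i using s(1)[of i] by auto
      then have "(\<lambda>i. \<bar>q (fst (s i)) - q (snd (s i))\<bar>) \<longlonglongrightarrow> \<bar>q (fst z) - q (snd z)\<bar>"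
        using cont z s(2) unfolding continuous_on_sequentially by (fastforce simp: o_def)
      moreover have "\<bar>q (fst (s i)) - q (snd (s i))\<bar> \<le> inverse (Suc n)" for i
        using m s(1)[of i] by (auto simp: I_def)
      ultimately show ?thesis by (meson LIMSEQ_le_const2)
    qed
    then show ?thesis by (intro exI[of _ m]) (force simp: I_def)
  qed
  have "\<exists>l. filterlim q (nhds l) (at_right 0)"
  proof -
    have "cauchy_filter (filtermap q (at_right 0))"
      unfolding cauchy_filter_metric_filtermap
    proof (intro allI impI)
      fix e :: real assume "e > 0"
      then obtain n where n: "inverse (real (Suc n)) < e" using reals_Archimedean by blast
      obtain m where m: "\<And>h k. 0 < h \<and> h < inverse (Suc m) \<and> 0 < k \<and> k < inverse (Suc m) \<Longrightarrow>
       \<bar>q h - q k\<bar> \<le> inverse (Suc n)" using *[of n] by blast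
      show "\<exists>P. eventually P (at_right 0) \<and> (\<forall>x y. P x \<and> P y \<longrightarrow> dist (q x) (q y) < e)"
      proof (intro exI conjI allI impI)
        show "\<forall>\<^sub>F x in at_right 0. 0 < x \<and> x < inverse (real (Suc m))"
          unfolding eventually_at_right_field by (intro exI[of _ "inverse (real (Suc m))"]) auto
        show "dist (q x) (q y) < e"
          if "(0 < x \<and> x < inverse (real (Suc m))) \<and> (0 < y \<and> y < inverse (real (Suc m)))" for x y
          using m[of x y] that n by (simp add: dist_real_def)
      qed
    qed
    moreover have "filtermap q (at_right 0) \<noteq> bot" by (simp add: filtermap_bot_iff)
    ultimately show ?thesis
      using complete_UNIV unfolding complete_uniform[of UNIV] filterlim_def by simp blast
  qed
  then show "\<exists>l. (q \<longlongrightarrow> l) (at_right 0)" .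
qed

text \<open>Allows a single point to be picked from an almost-everywhere statement, here one good
  translate.\<close>

lemma ae_filter_lborel_neq_bot: "ae_filter (lborel :: 'a::euclidean_space measure) \<noteq> bot"
  by (simp add: ae_filter_eq_bot_iff)

text \<open>The exceptional set meets every line in direction $v$ in a null set. By Fubini's theorem almost every
  translate of it along $v$ is null, hence so is the set itself.\<close>
lemma Lipschitz_directional_derivative:
  fixes f :: "'a::euclidean_space \<Rightarrow> real"
  assumes Lip: "\<And>x y. \<bar>f y - f x\<bar> \<le> B * norm (y - x)"
  shows "AE x in lborel. \<exists>l. ((\<lambda>k. (f (x + k *\<^sub>R v) - f x) / k) \<longlongrightarrow> l) (at_right 0)"
proof -
  have B: "B \<ge> 0"
  proof -
    obtain b :: 'a where "b \<in> Basis" using nonempty_Basis by blast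
    then show ?thesis using Lip[of b 0] by simp
  qed
  have contf: "continuous_on UNIV f"
    using B by (intro lipschitz_on_continuous_on[of B] lipschitz_onI) (auto simp: dist_norm intro: Lip)
  have fm [measurable]: "f \<in> borel_measurable borel" using contf by (rule borel_measurable_continuous_onI)
  define q where "q x k = (f (x + k *\<^sub>R v) - f x) / k" for x k
  define P where "P x \<longleftrightarrow> (\<exists>l. (q x \<longlongrightarrow> l) (at_right 0))" for x
  have qm [measurable]: "(\<lambda>x. q x k) \<in> borel_measurable borel" for k
    unfolding q_def by measurable
  have P_iff: "P x \<longleftrightarrow> (\<forall>n. \<exists>m. \<forall>h\<in>\<rat>. \<forall>k\<in>\<rat>. 0 < h \<and> h < inverse (Suc m) \<and> 0 < k \<and> k < inverse (Suc m) \<longrightarrow>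
       \<bar>q x h - q x k\<bar> \<le> inverse (Suc n))" for x
    unfolding P_def
    by (rule convergent_at_right_iff_Cauchy_Rats)
       (auto simp: q_def intro!: continuous_intros continuous_on_compose2[OF contf])
  have Pm [measurable]: "Measurable.pred borel P"
    unfolding P_iff[abs_def] Rats_def ball_simps by measurable
  have line: "AE s in lborel. P (x + s *\<^sub>R v)" for x
  proof -
    have "\<bar>f (x + t *\<^sub>R v) - f (x + s *\<^sub>R v)\<bar> \<le> (B * norm v) * \<bar>t - s\<bar>" for s t
      using Lip[of "x + t *\<^sub>R v" "x + s *\<^sub>R v"] by (simp flip: scaleR_left_diff_distrib add: mult_ac)
    from Lipschitz_real_right_derivative[of "\<lambda>s. f (x + s *\<^sub>R v)", OF this]
    show ?thesis by (simp add: P_def q_def[abs_def] scaleR_add_left add.assoc)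
  qed
  have m2 [measurable]: "Measurable.pred (lborel \<Otimes>\<^sub>M lborel) (\<lambda>z. P (fst z + snd z *\<^sub>R v))"
    by measurable
  have "AE x in lborel. AE s in lborel. P (x + s *\<^sub>R v)" using line by simp
  then have "AE z in lborel \<Otimes>\<^sub>M lborel. P (fst z + snd z *\<^sub>R v)"
    by (intro lborel_pair.AE_pair_measure) (rule predE[OF m2], simp)
  then have "AE s in lborel. AE x in lborel. P (x + s *\<^sub>R v)"
    using lborel_pair.AE_commute[of "\<lambda>x s. P (x + s *\<^sub>R v)"] line predE[OF m2]
    by (simp add: case_prod_beta)
  then obtain s where s: "AE x in lborel. P (x + s *\<^sub>R v)"
    by (meson eventually_happens' ae_filter_lborel_neq_bot)
  have "AE x in distr lborel borel ((+) (s *\<^sub>R v)). P x"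
    using s by (subst AE_distr_iff) (auto simp: add.commute)
  then show ?thesis
    unfolding lborel_distr_plus by (simp add: P_def q_def[abs_def])
qed

section \<open>Directional derivatives depend linearly on the direction, almost everywhere\<close>

lemma integrable_indicator_bounded:
  "\<lbrakk>bounded S; S \<in> sets borel\<rbrakk> \<Longrightarrow> integrable lborel (indicator S :: 'a::euclidean_space \<Rightarrow> real)"
  using emeasure_bounded_finite[of S] by (intro integrable_real_indicator) auto

definition recip_Suc :: "nat \<Rightarrow> real" where "recip_Suc n = inverse (real (Suc n))"

lemma recip_Suc_pos [simp]: "recip_Suc n > 0" and recip_Suc_le_1 [simp]: "recip_Suc n \<le> 1"
  by (simp_all add: recip_Suc_def divide_simps)

lemma recip_Suc_tendsto: "recip_Suc \<longlonglongrightarrow> 0"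
  unfolding recip_Suc_def[abs_def] by (rule LIMSEQ_inverse_real_of_nat)

lemma filterlim_recip_Suc: "filterlim recip_Suc (at_right 0) sequentially"
  by (intro tendsto_imp_filterlim_at_right recip_Suc_tendsto) simp

text \<open>A limit along one fixed sequence of increments is a Borel function of x, defined
  everywhere, and it suits dominated convergence. Where the one-sided directional derivative exists,
  the two agree.\<close>

definition forward_deriv :: "('a::euclidean_space \<Rightarrow> real) \<Rightarrow> 'a \<Rightarrow> 'a \<Rightarrow> real" where
  "forward_deriv f v x = lim (\<lambda>n. (f (x + recip_Suc n *\<^sub>R v) - f x) / recip_Suc n)"

context
  fixes f :: "'a::euclidean_space \<Rightarrow> real" and B :: real
  assumes Lip: "\<And>x y. \<bar>f y - f x\<bar> \<le> B * norm (y - x)"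
begin

abbreviation (input) "quot v n x \<equiv> (f (x + recip_Suc n *\<^sub>R v) - f x) / recip_Suc n"

lemma Lipschitz_const_nonneg: "B \<ge> 0"
proof -
  obtain b :: 'a where "b \<in> Basis" using nonempty_Basis by blast
  then show ?thesis using Lip[of b 0] by simp
qed

lemma Lipschitz_borel_measurable [measurable]: "f \<in> borel_measurable borel"
  by (intro borel_measurable_continuous_onI lipschitz_on_continuous_on[of B] lipschitz_onI)
     (auto simp: dist_norm intro: Lip Lipschitz_const_nonneg)

lemma quot_bound: "k > 0 \<Longrightarrow> \<bar>(f (x + k *\<^sub>R v) - f x) / k\<bar> \<le> B * norm v"
  using Lip[of "x + k *\<^sub>R v" x] by (simp add: field_simps)

lemma forward_deriv_measurable [measurable]: "forward_deriv f v \<in> borel_measurable borel"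
  unfolding forward_deriv_def[abs_def] by measurable

lemma forward_deriv_eqI:
  assumes "((\<lambda>k. (f (x + k *\<^sub>R v) - f x) / k) \<longlongrightarrow> l) (at_right 0)"
  shows "forward_deriv f v x = l"
proof -
  from filterlim_compose[OF assms filterlim_recip_Suc] show ?thesis
    unfolding forward_deriv_def by (rule limI)
qed

lemma AE_forward_deriv:
  "AE x in lborel. ((\<lambda>k. (f (x + k *\<^sub>R v) - f x) / k) \<longlongrightarrow> forward_deriv f v x) (at_right 0)"
  using Lipschitz_directional_derivative[of f B v, OF Lip]
  by eventually_elim (metis forward_deriv_eqI)

lemma AE_quot_tendsto: "AE x in lborel. (\<lambda>n. quot v n x) \<longlonglongrightarrow> forward_deriv f v x"
  using AE_forward_deriv[of v]
proof eventually_elim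
  case (elim x)
  from filterlim_compose[OF elim filterlim_recip_Suc] show ?case .
qed

lemma AE_forward_deriv_bound: "AE x in lborel. \<bar>forward_deriv f v x\<bar> \<le> B * norm v"
  using AE_quot_tendsto[of v]
proof eventually_elim
  case (elim x)
  have "(\<lambda>n. \<bar>quot v n x\<bar>) \<longlonglongrightarrow> \<bar>forward_deriv f v x\<bar>"
    by (rule tendsto_rabs[OF elim])
  then show ?case
    using quot_bound[of "recip_Suc _" x v] by (intro LIMSEQ_le_const2) auto
qed

lemma forward_deriv_integrable_cbox: "set_integrable lborel (cbox a b) (forward_deriv f v)"
  unfolding set_integrable_def
proof (rule Bochner_Integration.integrable_bound)
  show "integrable lborel (\<lambda>x. indicator (cbox a b) x *\<^sub>R (B * norm v))"
    by (intro integrable_scaleR_left integrable_indicator_bounded) simp_all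
  show "AE x in lborel. norm (indicator (cbox a b) x *\<^sub>R forward_deriv f v x)
      \<le> norm (indicator (cbox a b) x *\<^sub>R (B * norm v))"
    using AE_forward_deriv_bound[of v] by eventually_elim (auto simp: indicator_def)
qed simp

lemma quot_integrable_cbox:
  "set_integrable lborel (cbox a b) (\<lambda>x. quot v n (x + c))"
  unfolding set_integrable_def
proof (rule Bochner_Integration.integrable_bound)
  show "integrable lborel (\<lambda>x. indicator (cbox a b) x *\<^sub>R (B * norm v))"
    by (intro integrable_scaleR_left integrable_indicator_bounded) simp_all
  show "AE x in lborel. norm (indicator (cbox a b) x *\<^sub>R quot v n (x + c))
      \<le> norm (indicator (cbox a b) x *\<^sub>R (B * norm v))"
    using quot_bound[of "recip_Suc n" _ v]
    by (intro AE_I2) (auto simp: indicator_def intro: order_trans[OF _ abs_ge_self])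
qed measurable

text \<open>Moving the base point by a vanishing amount does not change the limit of the averaged
  difference quotients: after a substitution only the domain of integration moves.\<close>
lemma shifted_quot_average_tendsto:
  "(\<lambda>n. LINT x:cbox a b|lborel. quot v n (x + recip_Suc n *\<^sub>R u))
     \<longlonglongrightarrow> (LINT x:cbox a b|lborel. forward_deriv f v x)"
proof -
  let ?e = "\<lambda>n. recip_Suc n *\<^sub>R u"
  have shift: "(LINT x:cbox a b|lborel. quot v n (x + ?e n))
     = (LINT y|lborel. indicator (cbox a b) (y - ?e n) *\<^sub>R quot v n y)" for n
  proof -
    have "(LINT y|distr lborel borel ((+) (?e n)). indicator (cbox a b) (y - ?e n) *\<^sub>R quot v n y)
       = (LINT x|lborel. indicator (cbox a b) (?e n + x - ?e n) *\<^sub>R quot v n (?e n + x))"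
      by (rule integral_distr) measurable
    then show ?thesis
      unfolding lborel_distr_plus set_lebesgue_integral_def add.commute[of "?e n"] add_diff_cancel_right' by (rule sym)
  qed
  \<comment> \<open>Increments are at most 1, so all moved boxes lie in the ball of radius
    \<open>r + norm u\<close>; this yields the integrable majorant.\<close>
  obtain r where r: "\<And>x. x \<in> cbox a b \<Longrightarrow> norm x \<le> r"
    using bounded_cbox[of a b] unfolding bounded_iff by blast
  have e0: "?e \<longlonglongrightarrow> 0"
    using tendsto_scaleR[OF recip_Suc_tendsto tendsto_const[of u]] by simp
  \<comment> \<open>Off the frontier of the box the moved indicator is eventually constant, which
    gives pointwise convergence almost everywhere.\<close>
  have front: "AE y in lborel. y \<notin> frontier (cbox a b)"
    using negligible_convex_frontier[of "cbox a b"]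
    by (intro AE_not_in) (auto simp: negligible_iff_null_sets null_sets_completion_iff)
  have "(\<lambda>n. LINT y|lborel. indicator (cbox a b) (y - ?e n) *\<^sub>R quot v n y)
     \<longlonglongrightarrow> (LINT y|lborel. indicator (cbox a b) y *\<^sub>R forward_deriv f v y)"
  proof (rule integral_dominated_convergence[where w="\<lambda>y. indicator (cball 0 (r + norm u)) y *\<^sub>R (B * norm v)"])
    show "integrable lborel (\<lambda>y. indicator (cball (0::'a) (r + norm u)) y *\<^sub>R (B * norm v))"
      by (intro integrable_scaleR_left integrable_indicator_bounded) simp_all
    show "AE y in lborel. (\<lambda>n. indicator (cbox a b) (y - ?e n) *\<^sub>R quot v n y)
        \<longlonglongrightarrow> indicator (cbox a b) y *\<^sub>R forward_deriv f v y"
      using AE_quot_tendsto[of v] front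
    proof eventually_elim
      case (elim y)
      have lim: "(\<lambda>n. y - ?e n) \<longlonglongrightarrow> y" using tendsto_diff[OF tendsto_const e0] by simp
      have "\<forall>\<^sub>F n in sequentially. indicator (cbox a b) (y - ?e n) = (indicator (cbox a b) y :: real)"
      proof (cases "y \<in> cbox a b")
        case True
        then have "y \<in> interior (cbox a b)" using elim(2) by (simp add: frontier_def)
        from topological_tendstoD[OF lim open_interior this] show ?thesis
          by eventually_elim (use True interior_subset[of "cbox a b"] in \<open>auto simp: indicator_def\<close>)
      next
        case False
        then have "y \<in> - cbox a b" by simp
        from topological_tendstoD[OF lim _ this] show ?thesis
          using False by (auto simp: indicator_def elim!: eventually_mono)
      qed
      then have "(\<lambda>n. indicator (cbox a b) (y - ?e n) :: real) \<longlonglongrightarrow> indicator (cbox a b) y"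
        by (rule tendsto_eventually)
      from tendsto_scaleR[OF this elim(1)] show ?case .
    qed
    show "AE y in lborel. norm (indicator (cbox a b) (y - ?e n) *\<^sub>R quot v n y)
        \<le> indicator (cball 0 (r + norm u)) y *\<^sub>R (B * norm v)" for n
    proof (intro AE_I2)
      fix y
      have "norm y \<le> r + norm u" if "y - ?e n \<in> cbox a b"
      proof -
        have "norm (?e n) \<le> norm u" by (simp add: mult_left_le_one_le less_imp_le)
        moreover have "norm y \<le> norm (y - ?e n) + norm (?e n)" by (metis diff_add_cancel norm_triangle_ineq)
        ultimately show ?thesis using r[OF that] by linarith
      qed
      then show "norm (indicator (cbox a b) (y - ?e n) *\<^sub>R quot v n y)
        \<le> indicator (cball 0 (r + norm u)) y *\<^sub>R (B * norm v)"
        using quot_bound[of "recip_Suc n" y v] Lipschitz_const_nonneg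
        by (auto simp: indicator_def)
    qed
  qed measurable
  then show ?thesis unfolding set_lebesgue_integral_def[of _ _ "forward_deriv f v"] shift .
qed

text \<open>The quotient in direction u + v telescopes into one in direction u at x and one in
  direction v at a moved base point. The moving base point blocks a pointwise limit of the second
  term, but its averages over boxes converge.\<close>

lemma forward_deriv_add_average:
  "(LINT x:cbox a b|lborel. forward_deriv f (u + v) x)
     = (LINT x:cbox a b|lborel. forward_deriv f u x) + (LINT x:cbox a b|lborel. forward_deriv f v x)"
proof -
  let ?e = "\<lambda>n. recip_Suc n *\<^sub>R u"
  \<comment> \<open>The shift by 0 keeps the first summand in the form of
    \<open>quot_integrable_cbox\<close> and \<open>shifted_quot_average_tendsto\<close>, so both
    summands are handled alike.\<close>
  have "quot (u + v) n x = quot u n (x + 0) + quot v n (x + ?e n)" for n x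
    by (simp add: algebra_simps flip: add_divide_distrib)
  then have sum: "(LINT x:cbox a b|lborel. quot (u + v) n x)
    = (LINT x:cbox a b|lborel. quot u n (x + 0)) + (LINT x:cbox a b|lborel. quot v n (x + ?e n))" for n
    using set_integral_add(2)[OF quot_integrable_cbox quot_integrable_cbox] by presburger
  have lim: "(\<lambda>n. LINT x:cbox a b|lborel. quot w n (x + 0))
     \<longlonglongrightarrow> (LINT x:cbox a b|lborel. forward_deriv f w x)" for w
    using shifted_quot_average_tendsto[where u=0 and v=w] unfolding scaleR_zero_right by simp
  show ?thesis
  proof (rule LIMSEQ_unique)
    show "(\<lambda>n. LINT x:cbox a b|lborel. quot (u + v) n x)
       \<longlonglongrightarrow> (LINT x:cbox a b|lborel. forward_deriv f (u + v) x)"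
      using lim[of "u + v"] by simp
    show "(\<lambda>n. LINT x:cbox a b|lborel. quot (u + v) n x)
       \<longlonglongrightarrow> (LINT x:cbox a b|lborel. forward_deriv f u x) + (LINT x:cbox a b|lborel. forward_deriv f v x)"
      unfolding sum by (rule tendsto_add[OF lim shifted_quot_average_tendsto])
  qed
qed

text \<open>The defect g of additivity has integral 0 over every box, and by Lebesgue
  differentiation such a function vanishes almost everywhere.\<close>

lemma AE_forward_deriv_add:
  "AE x in lborel. forward_deriv f (u + v) x = forward_deriv f u x + forward_deriv f v x"
proof -
  define g where "g x = forward_deriv f (u + v) x - (forward_deriv f u x + forward_deriv f v x)" for x
  have gi: "set_integrable lborel (cbox a b) g" for a b
    unfolding g_def by (intro set_integral_diff set_integral_add forward_deriv_integrable_cbox)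
  have "(LINT x:cbox a b|lborel. g x) = 0" for a b
    unfolding g_def
    by (subst set_integral_diff set_integral_add, (intro set_integral_add forward_deriv_integrable_cbox)+)+
       (simp add: forward_deriv_add_average)
  then have g0: "g integrable_on cbox a b" "integral (cbox a b) g = 0" for a b
    using set_borel_integral_eq_integral[OF gi[of a b]] by auto
  obtain N where N: "negligible N"
    and lim: "\<And>x e. \<lbrakk>x \<notin> N; 0 < e\<rbrakk> \<Longrightarrow>
      \<exists>d>0. \<forall>k. 0 < k \<and> k < d \<longrightarrow> norm (integral (cbox x (x + k *\<^sub>R One)) g /\<^sub>R k ^ DIM('a) - g x) < e"
    by (rule integrable_ccontinuous_explicit[of g]) (use g0 in auto)
  have "g x = 0" if xN: "x \<notin> N" for x
  proof (rule ccontr)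
    assume "g x \<noteq> 0"
    then obtain d where "d > 0"
      and d: "\<And>k. 0 < k \<and> k < d \<longrightarrow> norm (integral (cbox x (x + k *\<^sub>R One)) g /\<^sub>R k ^ DIM('a) - g x) < \<bar>g x\<bar>"
      using lim[OF xN, of "\<bar>g x\<bar>"] by auto
    then show False using d[of "d / 2"] by (simp add: g0)
  qed
  then have "AE x in lebesgue. g x = 0"
    using N by (intro AE_I'[of N]) (auto simp: negligible_iff_null_sets)
  then show ?thesis by (simp add: AE_completion_iff g_def)
qed

lemma forward_deriv_0 [simp]: "forward_deriv f 0 x = 0"
  by (rule forward_deriv_eqI) simp

text \<open>A positive factor rescales the increment. One-sided quotients do not reach negative
  factors this way; those come from additivity applied to v and -v.\<close>

lemma AE_forward_deriv_scaleR:
  "AE x in lborel. forward_deriv f (c *\<^sub>R v) x = c * forward_deriv f v x"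
proof -
  have pos: "AE x in lborel. forward_deriv f (c *\<^sub>R v) x = c * forward_deriv f v x" if "c > 0" for c v
    using AE_forward_deriv[of v]
  proof eventually_elim
    case (elim x)
    have "filterlim (\<lambda>k. c * k) (at_right 0) (at_right 0)"
    proof (rule tendsto_imp_filterlim_at_right)
      show "((\<lambda>k. c * k) \<longlongrightarrow> 0) (at_right 0)"
        using tendsto_mult_left[OF tendsto_ident_at, of c 0 "{0<..}"] by simp
      show "\<forall>\<^sub>F k in at_right 0. 0 < c * k"
        using eventually_at_right_less[of 0] by eventually_elim (use \<open>c > 0\<close> in simp)
    qed
    from tendsto_mult_left[OF filterlim_compose[OF elim this], of c]
    have "((\<lambda>k. (f (x + k *\<^sub>R c *\<^sub>R v) - f x) / k) \<longlongrightarrow> c * forward_deriv f v x) (at_right 0)"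
      using \<open>c > 0\<close> by (simp add: mult.commute)
    then show ?case by (rule forward_deriv_eqI)
  qed
  consider "c > 0" | "c = 0" | "- c > 0" by linarith
  then show ?thesis
  proof cases
    case 3
    from pos[OF this, of "- v"] AE_forward_deriv_add[of v "- v"] show ?thesis
      by eventually_elim (simp add: eq_neg_iff_add_eq_0[symmetric] add_eq_0_iff)
  qed (use pos in auto)
qed

lemma AE_forward_deriv_linear:
  "AE x in lborel. forward_deriv f v x = (\<Sum>i\<in>Basis. (v \<bullet> i) * forward_deriv f i x)"
proof -
  have "AE x in lborel. forward_deriv f (\<Sum>i\<in>S. (v \<bullet> i) *\<^sub>R i) x = (\<Sum>i\<in>S. (v \<bullet> i) * forward_deriv f i x)"
    if "finite S" for S :: "'a set"
    using that
  proof induction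
    case (insert j S)
    show ?case
      using insert.IH AE_forward_deriv_add[of "(v \<bullet> j) *\<^sub>R j" "\<Sum>i\<in>S. (v \<bullet> i) *\<^sub>R i"]
        AE_forward_deriv_scaleR[of "v \<bullet> j" j]
      by eventually_elim (use insert.hyps in simp)
  qed simp
  from this[of Basis] show ?thesis by (simp add: euclidean_representation)
qed

text \<open>Compactness of the unit sphere makes the directional limits uniform: finitely many
  directions of V come \<eta>-close to every unit vector, and the Lipschitz bound on f and the
  boundedness of A carry the estimate over to all directions.\<close>

lemma has_derivative_from_dense_directions:
  fixes A :: "'a \<Rightarrow> real"
  assumes A: "linear A"
    and dense: "\<And>U. \<lbrakk>open U; U \<noteq> {}\<rbrakk> \<Longrightarrow> \<exists>v\<in>V. v \<in> U"
    and lim: "\<And>v. v \<in> V \<Longrightarrow> ((\<lambda>k. (f (x + k *\<^sub>R v) - f x) / k) \<longlongrightarrow> A v) (at_right 0)"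
  shows "(f has_derivative A) (at x)"
  unfolding has_derivative_at_alt
proof (intro conjI allI impI)
  show bl: "bounded_linear A" using A by (simp add: linear_conv_bounded_linear)
  obtain M where M: "M > 0" "\<And>w. \<bar>A w\<bar> \<le> norm w * M"
    using bounded_linear.pos_bounded[OF bl] by auto
  fix e :: real assume "e > 0"
  \<comment> \<open>Relative to the increment, moving the direction costs B \<eta> in f and M \<eta>
    in A, and the directional limit costs \<eta>; the sum is e.\<close>
  define \<eta> where "\<eta> = e / (B + M + 1)"
  have "\<eta> > 0" using \<open>e > 0\<close> M Lipschitz_const_nonneg by (simp add: \<eta>_def)
  have "sphere 0 1 \<subseteq> (\<Union>v\<in>V. ball v \<eta>)"
    using dense[of "ball _ \<eta>"] \<open>\<eta> > 0\<close> by (fastforce simp: dist_commute)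
  then obtain V' where V': "V' \<subseteq> V" "finite V'" "sphere 0 1 \<subseteq> (\<Union>v\<in>V'. ball v \<eta>)"
    using compactE_image[OF compact_sphere, of V "\<lambda>v. ball v \<eta>"] by (metis open_ball)
  have "\<forall>\<^sub>F k in at_right 0. \<forall>v\<in>V'. dist ((f (x + k *\<^sub>R v) - f x) / k) (A v) < \<eta>"
    using V' tendstoD[OF lim \<open>\<eta> > 0\<close>] by (auto intro!: eventually_ball_finite)
  then obtain d where "d > 0"
    and d: "\<And>k v. 0 < k \<Longrightarrow> k < d \<Longrightarrow> v \<in> V' \<Longrightarrow> \<bar>(f (x + k *\<^sub>R v) - f x) / k - A v\<bar> < \<eta>"
    by (auto simp: eventually_at_right_field dist_real_def)
  show "\<exists>d>0. \<forall>y. norm (y - x) < d \<longrightarrow> norm (f y - f x - A (y - x)) \<le> e * norm (y - x)"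
  proof (intro exI[of _ d] conjI allI impI \<open>d > 0\<close>)
    fix y assume y: "norm (y - x) < d"
    show "norm (f y - f x - A (y - x)) \<le> e * norm (y - x)"
    proof (cases "y = x")
      case False
      define k w where "k = norm (y - x)" and "w = (y - x) /\<^sub>R k"
      have k: "0 < k" "k < d" using False y by (auto simp: k_def)
      have yx: "y = x + k *\<^sub>R w" and w: "norm w = 1" using k by (auto simp: w_def k_def)
      then obtain v where v: "v \<in> V'" "norm (w - v) < \<eta>"
        using V'(3) by (force simp: dist_norm norm_minus_commute)
      have 1: "\<bar>f (x + k *\<^sub>R w) - f (x + k *\<^sub>R v)\<bar> \<le> k * (B * \<eta>)"
      proof -
        have "\<bar>f (x + k *\<^sub>R w) - f (x + k *\<^sub>R v)\<bar> \<le> B * (k * norm (w - v))"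
          using Lip[of "x + k *\<^sub>R w" "x + k *\<^sub>R v"] k by (simp flip: scaleR_diff_right)
        also have "\<dots> \<le> B * (k * \<eta>)"
          using v k Lipschitz_const_nonneg by (intro mult_left_mono) auto
        finally show ?thesis by (simp add: mult_ac)
      qed
      have 2: "\<bar>f (x + k *\<^sub>R v) - f x - k * A v\<bar> \<le> k * \<eta>"
      proof -
        have "f (x + k *\<^sub>R v) - f x - k * A v = k * ((f (x + k *\<^sub>R v) - f x) / k - A v)"
          using k by (simp add: field_simps)
        then show ?thesis using d[OF k v(1)] k by (simp add: abs_mult)
      qed
      have 3: "\<bar>k * A v - k * A w\<bar> \<le> k * (M * \<eta>)"
      proof -
        have "k * A v - k * A w = - k * A (w - v)" by (simp add: linear_diff[OF A] right_diff_distrib)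
        moreover have "\<bar>A (w - v)\<bar> \<le> \<eta> * M" using M(2)[of "w - v"] v M(1) by (smt (verit) mult_right_mono)
        ultimately show ?thesis using k by (simp add: abs_mult mult_ac)
      qed
      have "A (y - x) = k * A w" using linear_scale[OF A, of k w] by (simp add: yx)
      then have "\<bar>f y - f x - A (y - x)\<bar> \<le> k * (B * \<eta>) + k * \<eta> + k * (M * \<eta>)"
        using 1 2 3 unfolding yx by linarith
      also have "\<dots> = k * ((B + M + 1) * \<eta>)" by (simp add: algebra_simps)
      also have "\<dots> = e * norm (y - x)" using M Lipschitz_const_nonneg by (simp add: \<eta>_def k_def)
      finally show ?thesis by simp
    qed (use linear_0[OF A] in simp)
  qed
qed

text \<open>Each direction has its own exceptional null set, so only countably many can be treated
  at once; a countable dense set of directions is enough.\<close>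

lemma Lipschitz_AE_differentiable_real: "AE x in lborel. f differentiable at x"
proof -
  obtain V :: "'a set" where V: "countable V" "\<And>U. \<lbrakk>open U; U \<noteq> {}\<rbrakk> \<Longrightarrow> \<exists>v\<in>V. v \<in> U"
    using countable_dense_exists[where 'a='a] by (metis)
  have "AE x in lborel. \<forall>v\<in>V. ((\<lambda>k. (f (x + k *\<^sub>R v) - f x) / k) \<longlongrightarrow> forward_deriv f v x) (at_right 0)"
    by (intro AE_ball_countable[OF V(1), THEN iffD2] ballI AE_forward_deriv)
  moreover have "AE x in lborel. \<forall>v\<in>V. forward_deriv f v x = (\<Sum>i\<in>Basis. (v \<bullet> i) * forward_deriv f i x)"
    by (intro AE_ball_countable[OF V(1), THEN iffD2] ballI AE_forward_deriv_linear)
  ultimately show ?thesis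
  proof eventually_elim
    case (elim x)
    have "linear (\<lambda>v. \<Sum>i\<in>Basis. (v \<bullet> i) * forward_deriv f i x)"
      by (rule linearI) (simp_all add: inner_add_left algebra_simps sum.distrib sum_distrib_left)
    from has_derivative_from_dense_directions[OF this V(2), of x] elim show ?case
      unfolding differentiable_def by force
  qed
qed

end

theorem Rademacher:
  fixes g :: "'a::euclidean_space \<Rightarrow> 'b::euclidean_space"
  assumes "B-lipschitz_on UNIV g"
  shows "AE x in lebesgue. g differentiable at x"
proof -
  have "\<bar>g y \<bullet> i - g x \<bullet> i\<bar> \<le> B * norm (y - x)" if "i \<in> Basis" for i x y
  proof -
    have "\<bar>g y \<bullet> i - g x \<bullet> i\<bar> \<le> norm (g y - g x)"
      using Basis_le_norm[OF that, of "g y - g x"] by (simp add: inner_diff_left)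
    then show ?thesis using lipschitz_onD[OF assms, of y x] by (simp add: dist_norm)
  qed
  then have "AE x in lborel. \<forall>i\<in>Basis. (\<lambda>x. g x \<bullet> i) differentiable at x"
    by (intro AE_ball_countable[THEN iffD2] ballI Lipschitz_AE_differentiable_real)
       (auto intro: countable_finite)
  then have "AE x in lborel. g differentiable at x"
    by (auto simp: differentiable_componentwise_within[of g])
  then show ?thesis by (rule AE_completion)
qed

subsection \<open>Gronwall's inequality for absolutely continuous curves\<close>

lemma abs_continuous_curve_subinterval:
  assumes "abs_continuous_curve a b \<gamma>" "a \<le> c" "d \<le> b"
  shows "abs_continuous_curve c d \<gamma>"
proof -
  have "{c..d} \<subseteq> {a..b}" using assms by auto
  then show ?thesis using assms(1) unfolding abs_continuous_curve_def by (meson order_trans)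
qed

lemma abs_continuous_curve_imp_continuous_on:
  assumes "abs_continuous_curve a b \<gamma>"
  shows "continuous_on {a..b} \<gamma>"
  unfolding continuous_on_iff
proof (intro ballI allI impI)
  fix t e :: real assume t: "t \<in> {a..b}" and "e > 0"
  then obtain d where "d > 0" and d: "\<And>D S. D division_of S \<Longrightarrow> S \<subseteq> {a..b} \<Longrightarrow> (\<Sum>K\<in>D. Sup K - Inf K) < d
        \<Longrightarrow> (\<Sum>K\<in>D. norm (\<gamma> (Sup K) - \<gamma> (Inf K))) < e"
    using assms unfolding abs_continuous_curve_def by meson
  have *: "norm (\<gamma> v - \<gamma> u) < e" if "u \<in> {a..b}" "v \<in> {a..b}" "u \<le> v" "v - u < d" for u v
  proof -
    have "{{u..v}} division_of {u..v}" using division_of_self[of u v] that by simp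
    from d[OF this] that show ?thesis by simp
  qed
  show "\<exists>d>0. \<forall>u\<in>{a..b}. dist u t < d \<longrightarrow> dist (\<gamma> u) (\<gamma> t) < e"
  proof (intro exI[of _ d] conjI ballI impI \<open>d > 0\<close>)
    fix u assume "u \<in> {a..b}" "dist u t < d"
    then show "dist (\<gamma> u) (\<gamma> t) < e"
      using *[of u t] *[of t u] t by (cases "u \<le> t") (auto simp: dist_norm norm_minus_commute)
  qed
qed

lemma division_of_Sup_Inf_mem:
  fixes D :: "real set set"
  assumes "D division_of S" "S \<subseteq> {a..b}" "K \<in> D"
  shows "Sup K \<in> {a..b}" "Inf K \<in> {a..b}"
proof -
  obtain u v where K: "K = {u..v}" "K \<noteq> {}" "K \<subseteq> S"
    using division_ofD(2-4)[OF assms(1,3)] by (metis box_real(2))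
  then have "u \<le> v" by auto
  moreover have "u \<in> {a..b}" "v \<in> {a..b}" using K assms(2) \<open>u \<le> v\<close> by (meson atLeastAtMost_iff order_refl subsetD)+
  ultimately show "Sup K \<in> {a..b}" "Inf K \<in> {a..b}" using K(1) by auto
qed

text \<open>Used for the logarithm of the shifted squared distance, whose increments are bounded by
  those of the two trajectories.\<close>

lemma abs_continuous_curve_dominated:
  assumes X: "abs_continuous_curve a b X" and Y: "abs_continuous_curve a b Y"
    and dom: "\<And>u v. \<lbrakk>u \<in> {a..b}; v \<in> {a..b}\<rbrakk> \<Longrightarrow> norm (h v - h u) \<le> L * (norm (X v - X u) + norm (Y v - Y u))"
  shows "abs_continuous_curve a b h"
  unfolding abs_continuous_curve_def
proof (intro allI impI)
  fix e :: real assume "e > 0"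
  \<comment> \<open>Half of the error goes to each curve; \<open>\<bar>L\<bar> + 1\<close> is a
    positive bound for L whatever its sign.\<close>
  define c where "c = e / (2 * (\<bar>L\<bar> + 1))"
  have "c > 0" using \<open>e > 0\<close> by (simp add: c_def)
  obtain d1 where "d1 > 0" and d1: "\<And>D S. D division_of S \<Longrightarrow> S \<subseteq> {a..b} \<Longrightarrow> (\<Sum>K\<in>D. Sup K - Inf K) < d1
        \<Longrightarrow> (\<Sum>K\<in>D. norm (X (Sup K) - X (Inf K))) < c"
    using X \<open>c > 0\<close> unfolding abs_continuous_curve_def by meson
  obtain d2 where "d2 > 0" and d2: "\<And>D S. D division_of S \<Longrightarrow> S \<subseteq> {a..b} \<Longrightarrow> (\<Sum>K\<in>D. Sup K - Inf K) < d2
        \<Longrightarrow> (\<Sum>K\<in>D. norm (Y (Sup K) - Y (Inf K))) < c"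
    using Y \<open>c > 0\<close> unfolding abs_continuous_curve_def by meson
  show "\<exists>\<delta>>0. \<forall>D S. D division_of S \<and> S \<subseteq> {a..b} \<and> (\<Sum>K\<in>D. Sup K - Inf K) < \<delta>
        \<longrightarrow> (\<Sum>K\<in>D. norm (h (Sup K) - h (Inf K))) < e"
  proof (intro exI[of _ "min d1 d2"] conjI allI impI)
    fix D S assume D: "D division_of S \<and> S \<subseteq> {a..b} \<and> (\<Sum>K\<in>D. Sup K - Inf K) < min d1 d2"
    have "(\<Sum>K\<in>D. norm (h (Sup K) - h (Inf K)))
        \<le> (\<Sum>K\<in>D. (\<bar>L\<bar> + 1) * (norm (X (Sup K) - X (Inf K)) + norm (Y (Sup K) - Y (Inf K))))"
    proof (rule sum_mono)
      fix K assume "K \<in> D"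
      then have "Sup K \<in> {a..b}" "Inf K \<in> {a..b}" using D division_of_Sup_Inf_mem by blast+
      from dom[OF this(2,1)] show "norm (h (Sup K) - h (Inf K))
          \<le> (\<bar>L\<bar> + 1) * (norm (X (Sup K) - X (Inf K)) + norm (Y (Sup K) - Y (Inf K)))"
        by (rule order_trans) (intro mult_right_mono, auto)
    qed
    also have "\<dots> = (\<bar>L\<bar> + 1) * ((\<Sum>K\<in>D. norm (X (Sup K) - X (Inf K))) + (\<Sum>K\<in>D. norm (Y (Sup K) - Y (Inf K))))"
      by (simp only: sum_distrib_left[symmetric] sum.distrib)
    also have "\<dots> < (\<bar>L\<bar> + 1) * (c + c)"
      using D d1[of D S] d2[of D S] by (intro mult_strict_left_mono add_strict_mono) auto
    also have "\<dots> = e" unfolding c_def by (simp add: divide_simps)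
    finally show "(\<Sum>K\<in>D. norm (h (Sup K) - h (Inf K))) < e" .
  qed (use \<open>d1 > 0\<close> \<open>d2 > 0\<close> in auto)
qed

text \<open>On a fine tagged division the intervals tagged at points of differentiability satisfy the
  inequality up to a small error, while the intervals tagged in the exceptional null set have
  arbitrarily small total length, so that absolute continuity controls them.\<close>
lemma abs_continuous_curve_increment_ge_integral:
  fixes g k :: "real \<Rightarrow> real"
  assumes "a \<le> b" and ac: "abs_continuous_curve a b g" and k: "k integrable_on {a..b}"
    and der: "AE t in lebesgue. t \<in> {a..b} \<longrightarrow> (\<exists>d\<ge>k t. (g has_vector_derivative d) (at t within {a..b}))"
  shows "integral {a..b} k \<le> g b - g a"
proof (rule field_le_epsilon)
  fix e0 :: real assume "e0 > 0"
  \<comment> \<open>Shares of the error: e for the Riemann sum, e for the intervals tagged in N, and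
    \<open>e * (b - a)\<close> for the differentiability errors accumulated over the whole
    interval.\<close>
  define e where "e = e0 / (2 + (b - a))"
  have "e > 0" and e0: "e + e + e * (b - a) = e0"
  proof -
    have "e * (2 + (b - a)) = e0" using \<open>a \<le> b\<close> by (simp add: e_def)
    then show "e + e + e * (b - a) = e0" by (simp add: algebra_simps)
  qed (use \<open>e0 > 0\<close> \<open>a \<le> b\<close> in \<open>simp add: e_def\<close>)
  obtain N where N: "negligible N" and
    Nd: "\<And>t. t \<in> {a..b} - N \<Longrightarrow> \<exists>d\<ge>k t. (g has_vector_derivative d) (at t within {a..b})"
    using der by (elim AE_E3) (force simp: negligible_iff_null_sets)
  then obtain d where d: "\<And>t. t \<in> {a..b} - N \<Longrightarrow> k t \<le> d t"
      "\<And>t. t \<in> {a..b} - N \<Longrightarrow> (g has_vector_derivative d t) (at t within {a..b})"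
    by metis
  \<comment> \<open>Setting the integrand to 0 on N leaves the integral unchanged and removes its
    uncontrolled values there from the Riemann sums.\<close>
  define k' where "k' t = (if t \<in> N then 0 else k t)" for t
  have "(k' has_integral integral {a..b} k) (cbox a b)"
    using integrable_integral[OF k] N by (intro has_integral_spike[of N _ k' k]) (auto simp: k'_def)
  then obtain \<gamma>1 where \<gamma>1: "gauge \<gamma>1" "\<And>p. p tagged_division_of cbox a b \<Longrightarrow> \<gamma>1 fine p \<Longrightarrow>
      norm ((\<Sum>(x,K)\<in>p. measure lborel K *\<^sub>R k' x) - integral {a..b} k) < e"
    using \<open>e > 0\<close> unfolding has_integral by meson
  obtain \<delta> where "\<delta> > 0" and \<delta>: "\<And>D S. D division_of S \<Longrightarrow> S \<subseteq> {a..b} \<Longrightarrow> (\<Sum>K\<in>D. Sup K - Inf K) < \<delta>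
        \<Longrightarrow> (\<Sum>K\<in>D. norm (g (Sup K) - g (Inf K))) < e"
    using ac \<open>e > 0\<close> unfolding abs_continuous_curve_def by meson
  obtain U where U: "open U" "N \<subseteq> U" "U \<in> lmeasurable" "measure lebesgue U < \<delta>"
  proof -
    have N0: "N \<in> null_sets lebesgue" using N by (simp add: negligible_iff_null_sets)
    obtain U where U: "open U" "N \<subseteq> U" "emeasure lebesgue (U - N) < ennreal \<delta>"
      using sets_lebesgue_outer_open[of N \<delta>] N0 \<open>\<delta> > 0\<close> by blast
    have em: "emeasure lebesgue U < ennreal \<delta>"
      using U emeasure_Diff_null_set[OF N0, of U] by simp
    then have "U \<in> lmeasurable" using U(1) by (intro fmeasurableI) (auto simp: order_less_le_trans)
    moreover have "measure lebesgue U < \<delta>"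
      using em \<open>\<delta> > 0\<close> calculation by (simp add: emeasure_eq_measure2 ennreal_less_iff)
    ultimately show thesis using that U by blast
  qed
  have "\<exists>r>0. \<forall>u\<in>{a..b}. \<bar>u - t\<bar> < r \<longrightarrow> \<bar>g u - g t - (u - t) * d t\<bar> \<le> e * \<bar>u - t\<bar>"
    if "t \<in> {a..b} - N" for t
    using d(2)[OF that] \<open>e > 0\<close>
    unfolding has_vector_derivative_def has_derivative_within_alt by (auto simp: real_norm_def)
  then obtain r where r: "\<And>t. t \<in> {a..b} - N \<Longrightarrow> r t > 0"
      "\<And>t u. \<lbrakk>t \<in> {a..b} - N; u \<in> {a..b}; \<bar>u - t\<bar> < r t\<rbrakk> \<Longrightarrow> \<bar>g u - g t - (u - t) * d t\<bar> \<le> e * \<bar>u - t\<bar>"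
    by metis
  \<comment> \<open>Intervals tagged in N are forced into the small open set U, the others into the
    range of the derivative estimate; tags outside [a,b] do not occur, so any radius serves
    there.\<close>
  define \<gamma>2 where "\<gamma>2 t = (if t \<in> N then U else if t \<in> {a..b} then ball t (r t) else ball t 1)" for t
  have "gauge \<gamma>2" unfolding gauge_def \<gamma>2_def using U r by auto
  then obtain p where p: "p tagged_division_of {a..b}" "\<gamma>1 fine p" "\<gamma>2 fine p"
    using fine_division_exists_real[OF gauge_Int[OF \<gamma>1(1)]] by (metis fine_Int)
  have pK: "\<exists>u v. K = {u..v} \<and> u \<le> v \<and> t \<in> {u..v} \<and> {u..v} \<subseteq> {a..b}" if "(t, K) \<in> p" for t K
  proof -
    have "\<exists>u v. K = cbox u v" "t \<in> K" "K \<subseteq> {a..b}"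
      using that tagged_division_ofD(2-4)[OF p(1)] by blast+
    then show ?thesis by (metis box_real(2) atLeastAtMost_iff order_trans)
  qed
  have fin: "finite p" using p(1) by (rule tagged_division_of_finite)
  define p1 where "p1 = {z \<in> p. fst z \<in> N}"
  define inc where "inc K = g (Sup K) - g (Inf K)" for K
  have p1_small: "(\<Sum>(t,K)\<in>p1. \<bar>inc K\<bar>) < e"
  proof -
    define D where "D = snd ` p1"
    \<comment> \<open>Distinct tags may share a degenerate interval, so passing from tagged
      intervals to intervals needs a function that vanishes on those of empty interior. A degenerate
      interval has increment 0, so c agrees with \<open>\<bar>inc K\<bar>\<close> on D.\<close>
    define c where "c K = (if measure lborel K = 0 then 0 else \<bar>inc K\<bar>)" for K :: "real set"
    have "p1 tagged_partial_division_of {a..b}"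
      by (rule tagged_partial_division_subset[of p]) (use p(1) in \<open>auto simp: p1_def tagged_division_of_def\<close>)
    then have p1: "p1 tagged_division_of \<Union>D"
      unfolding D_def by (rule tagged_partial_division_of_Union_self)
    have DU: "D division_of \<Union>D" unfolding D_def
      using division_of_tagged_division[OF p1] by (simp add: D_def)
    have Dab: "\<Union>D \<subseteq> {a..b}" using pK by (fastforce simp: D_def p1_def)
    have DK: "\<exists>t\<in>N. (t, K) \<in> p" if KD: "K \<in> D" for K
    proof -
      obtain z where "z \<in> p" "fst z \<in> N" "K = snd z" using KD unfolding D_def p1_def by blast
      then show ?thesis by (cases z) auto
    qed
    have "K \<subseteq> U" if KD: "K \<in> D" for K
    proof -
      obtain t where "(t, K) \<in> p" "t \<in> N" using DK[OF KD] by blast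
      then show ?thesis using fineD[OF p(3), of t K] by (simp add: \<gamma>2_def)
    qed
    then have "\<Union>D \<subseteq> U" by blast
    have cK: "c K = \<bar>inc K\<bar>" "Sup K - Inf K = measure lebesgue K" if KD: "K \<in> D" for K
    proof -
      obtain u v where "K = {u..v}" "u \<le> v" using DK[OF KD] pK by blast
      then show "c K = \<bar>inc K\<bar>" "Sup K - Inf K = measure lebesgue K" by (auto simp: c_def inc_def)
    qed
    have "(\<Sum>K\<in>D. Sup K - Inf K) = measure lebesgue (\<Union>D)"
      using content_division[OF DU] cK(2) by simp
    also have "\<dots> \<le> measure lebesgue U"
      using \<open>\<Union>D \<subseteq> U\<close> U(3) DU by (intro measure_mono_fmeasurable) (auto intro: lmeasurable_division fmeasurableD)
    finally have small: "(\<Sum>K\<in>D. norm (g (Sup K) - g (Inf K))) < e"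
      using U(4) by (intro \<delta>[OF DU Dab]) simp
    have "(\<Sum>(t,K)\<in>p1. \<bar>inc K\<bar>) = (\<Sum>(t,K)\<in>p1. c K)"
      using cK by (intro sum.cong) (auto simp: D_def rev_image_eqI)
    also have "\<dots> = sum c (snd ` p1)"
      by (rule sum.over_tagged_division_lemma[OF p1]) (simp add: c_def content_eq_0_interior)
    also have "\<dots> = (\<Sum>K\<in>D. norm (g (Sup K) - g (Inf K)))"
      unfolding D_def[symmetric] by (intro sum.cong) (auto simp: cK inc_def)
    finally show ?thesis using small by simp
  qed
  have ineq: "measure lborel K * k' t - e * measure lborel K - (if t \<in> N then \<bar>inc K\<bar> else 0) \<le> inc K" if tK: "(t, K) \<in> p" for t K
  proof -
    obtain u v where K: "K = {u..v}" "u \<le> v" "t \<in> {u..v}" "{u..v} \<subseteq> {a..b}" using pK[OF tK] by blast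
    show ?thesis
    proof (cases "t \<in> N")
      case True
      have "e * measure lborel K \<ge> 0" using \<open>e > 0\<close> by simp
      then show ?thesis using True unfolding k'_def by simp
    next
      case False
      then have t: "t \<in> {a..b} - N" using K by auto
      have "{u..v} \<subseteq> ball t (r t)" using fineD[OF p(3) tK] t False K(1) by (simp add: \<gamma>2_def)
      then have "\<bar>u - t\<bar> < r t" "\<bar>v - t\<bar> < r t" using K(2) by (auto simp: dist_real_def subset_iff abs_minus_commute)
      moreover have "u \<in> {a..b}" "v \<in> {a..b}" using K by auto
      ultimately have "\<bar>g u - g t - (u - t) * d t\<bar> \<le> e * \<bar>u - t\<bar>" "\<bar>g v - g t - (v - t) * d t\<bar> \<le> e * \<bar>v - t\<bar>"
        using r(2)[OF t] by blast+
      \<comment> \<open>The tag lies between u and v, so the two errors add up to exactly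
        \<open>e * (v - u)\<close>.\<close>
      then have "(v - u) * d t - e * (v - u) \<le> g v - g u"
        using K(3) by (auto simp: algebra_simps abs_le_iff)
      moreover have "(v - u) * k t \<le> (v - u) * d t" using d(1)[OF t] K(2) by (intro mult_left_mono) auto
      ultimately show ?thesis using False K by (simp add: k'_def inc_def)
    qed
  qed
  have "(\<Sum>(t,K)\<in>p. measure lborel K * k' t) - e * (\<Sum>(t,K)\<in>p. measure lborel K) - (\<Sum>(t,K)\<in>p1. \<bar>inc K\<bar>)
      = (\<Sum>(t,K)\<in>p. measure lborel K * k' t - e * measure lborel K - (if t \<in> N then \<bar>inc K\<bar> else 0))"
    unfolding p1_def using fin
    by (simp add: sum_subtractf sum_distrib_left case_prod_beta sum.inter_filter)
  also have "\<dots> \<le> (\<Sum>(t,K)\<in>p. inc K)" using ineq by (intro sum_mono) auto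
  also have "\<dots> = g b - g a" unfolding inc_def by (rule additive_tagged_division_1[OF \<open>a \<le> b\<close> p(1)])
  finally have "(\<Sum>(t,K)\<in>p. measure lborel K * k' t) \<le> g b - g a + e * (b - a) + e"
    using additive_content_tagged_division[of p a b] p(1) p1_small \<open>a \<le> b\<close> by simp
  moreover have "integral {a..b} k < (\<Sum>(t,K)\<in>p. measure lborel K * k' t) + e"
    using \<gamma>1(2)[of p] p by (simp add: abs_less_iff)
  ultimately show "integral {a..b} k \<le> g b - g a + e0" using e0 by linarith
qed

lemma abs_diff_ln_le:
  fixes p q e :: real
  assumes "e > 0" "p \<ge> e" "q \<ge> e"
  shows "\<bar>ln p - ln q\<bar> \<le> \<bar>p - q\<bar> / e"
proof -
  have *: "ln p - ln q \<le> \<bar>p - q\<bar> / e" if "p \<ge> e" "q \<ge> e" for p q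
  proof -
    have "ln p - ln q = ln (p / q)" using that assms by (simp add: ln_div)
    also have "\<dots> \<le> p / q - 1" using that assms by (intro ln_le_minus_one) simp
    also have "\<dots> = (p - q) / q" using that assms by (simp add: field_simps)
    also have "\<dots> \<le> \<bar>p - q\<bar> / e" using that assms by (intro frac_le) auto
    finally show ?thesis .
  qed
  show ?thesis using *[of p q] *[of q p] assms by (auto simp: abs_le_iff abs_minus_commute)
qed

lemma one_sided_Gronwall:
  fixes X Y :: "real \<Rightarrow> 'a::real_inner"
  assumes rs: "a \<le> r" "r \<le> s" "s \<le> b"
    and X: "abs_continuous_curve a b X" and Y: "abs_continuous_curve a b Y"
    and C: "C integrable_on {a..b}" "\<And>t. t \<in> {a..b} \<Longrightarrow> C t \<ge> 0"
    and der: "AE t in lebesgue. t \<in> {a..b} \<longrightarrow> (\<exists>v w. (X has_vector_derivative v) (at t within {a..b}) \<and>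
       (Y has_vector_derivative w) (at t within {a..b}) \<and> (v - w) \<bullet> (X t - Y t) \<ge> - C t * (norm (X t - Y t))\<^sup>2)"
  shows "norm (X r - Y r) \<le> exp (integral {a..b} C) * norm (X s - Y s)"
proof -
  define Z where "Z t = X t - Y t" for t
  define E where "E = integral {a..b} C"
  have sub: "{r..s} \<subseteq> {a..b}" using rs by auto
  have X': "abs_continuous_curve r s X" and Y': "abs_continuous_curve r s Y"
    using X Y rs by (auto intro: abs_continuous_curve_subinterval)
  have "continuous_on {r..s} Z"
    unfolding Z_def by (intro continuous_intros abs_continuous_curve_imp_continuous_on X' Y')
  then have "bounded (Z ` {r..s})" by (intro compact_imp_bounded compact_continuous_image) auto
  then obtain M where M: "\<And>t. t \<in> {r..s} \<Longrightarrow> norm (Z t) \<le> M" unfolding bounded_iff by blast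
  \<comment> \<open>The shift by e keeps the logarithm finite where the trajectories have merged.
    The factor \<open>exp (2 * E)\<close> is independent of e, which is removed at the end.\<close>
  have eps: "Z r \<bullet> Z r + e \<le> exp (2 * E) * (Z s \<bullet> Z s + e)" if "e > 0" for e
  proof -
    define h where "h t = ln (Z t \<bullet> Z t + e)" for t
    have pos: "Z t \<bullet> Z t + e > 0" for t using \<open>e > 0\<close> by (simp add: add_nonneg_pos)
    have "abs_continuous_curve r s h"
    \<comment> \<open>The factor \<open>1 / e\<close> is the Lipschitz constant of ln on [e,
      \<infinity>), and \<open>2 * M\<close> bounds the norm of \<open>Z v + Z u\<close> in the
      factored difference of squares.\<close>
    proof (rule abs_continuous_curve_dominated[OF X' Y', of h "2 * M / e"])
      fix u v assume uv: "u \<in> {r..s}" "v \<in> {r..s}"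
      have "norm (h v - h u) \<le> \<bar>(Z v \<bullet> Z v + e) - (Z u \<bullet> Z u + e)\<bar> / e"
        unfolding h_def real_norm_def by (rule abs_diff_ln_le[OF \<open>e > 0\<close>]) auto
      also have "(Z v \<bullet> Z v + e) - (Z u \<bullet> Z u + e) = (Z v + Z u) \<bullet> (Z v - Z u)"
        by (simp add: inner_simps inner_commute)
      also have "\<bar>(Z v + Z u) \<bullet> (Z v - Z u)\<bar> \<le> norm (Z v + Z u) * norm (Z v - Z u)"
        by (rule Cauchy_Schwarz_ineq2)
      also have "\<dots> \<le> (2 * M) * (norm (X v - X u) + norm (Y v - Y u))"
      proof (rule mult_mono)
        show "norm (Z v + Z u) \<le> 2 * M" using norm_triangle_ineq[of "Z v" "Z u"] M[OF uv(1)] M[OF uv(2)] by linarith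
        then show "0 \<le> 2 * M" by (rule order_trans[OF norm_ge_zero])
        have "Z v - Z u = (X v - X u) - (Y v - Y u)" by (simp add: Z_def)
        then show "norm (Z v - Z u) \<le> norm (X v - X u) + norm (Y v - Y u)"
          by (metis norm_triangle_ineq4)
      qed simp
      finally show "norm (h v - h u) \<le> 2 * M / e * (norm (X v - X u) + norm (Y v - Y u))"
        using \<open>e > 0\<close> by (simp add: divide_right_mono)
    qed
    moreover have "(\<lambda>t. - 2 * C t) integrable_on {r..s}"
      using integrable_on_cmult_left[OF integrable_subinterval_real[OF C(1) sub], of "- 2"] by simp
    moreover have "AE t in lebesgue. t \<in> {r..s} \<longrightarrow> (\<exists>d\<ge>- 2 * C t. (h has_vector_derivative d) (at t within {r..s}))"
      using der
    proof eventually_elim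
      case (elim t)
      show ?case
      proof
        assume t: "t \<in> {r..s}"
        then obtain v w where vw: "(X has_vector_derivative v) (at t within {a..b})"
            "(Y has_vector_derivative w) (at t within {a..b})" "(v - w) \<bullet> Z t \<ge> - C t * (Z t \<bullet> Z t)"
          using elim sub by (auto simp: Z_def power2_norm_eq_inner)
        have Zd: "(Z has_derivative (\<lambda>x. x *\<^sub>R (v - w))) (at t within {r..s})"
          using has_vector_derivative_within_subset[OF has_vector_derivative_diff[OF vw(1,2)] sub]
          unfolding has_vector_derivative_def Z_def .
        have "(h has_derivative (\<lambda>x. (Z t \<bullet> (x *\<^sub>R (v - w)) + (x *\<^sub>R (v - w)) \<bullet> Z t) * inverse (Z t \<bullet> Z t + e))) (at t within {r..s})"
          unfolding h_def using pos by (auto intro!: derivative_eq_intros Zd simp: divide_inverse)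
        moreover have "(\<lambda>x. (Z t \<bullet> (x *\<^sub>R (v - w)) + (x *\<^sub>R (v - w)) \<bullet> Z t) * inverse (Z t \<bullet> Z t + e))
            = (\<lambda>x. x *\<^sub>R (2 * ((v - w) \<bullet> Z t) / (Z t \<bullet> Z t + e)))"
          by (simp add: fun_eq_iff inner_commute divide_inverse algebra_simps)
        ultimately have hd: "(h has_vector_derivative (2 * ((v - w) \<bullet> Z t) / (Z t \<bullet> Z t + e))) (at t within {r..s})"
          by (simp add: has_vector_derivative_def)
        \<comment> \<open>Nonnegativity of C pays for the shift: it bounds
          \<open>- 2 * C t * e\<close> by 0.\<close>
        have "C t \<ge> 0" using C(2) t sub by auto
        then have "C t * e \<ge> 0" using \<open>e > 0\<close> by simp
        then have "- 2 * C t * (Z t \<bullet> Z t + e) \<le> 2 * ((v - w) \<bullet> Z t)"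
          using vw(3) by (simp add: algebra_simps)
        then have "- 2 * C t \<le> 2 * ((v - w) \<bullet> Z t) / (Z t \<bullet> Z t + e)"
          using pos by (simp add: pos_le_divide_eq)
        with hd show "\<exists>d\<ge>- 2 * C t. (h has_vector_derivative d) (at t within {r..s})" by blast
      qed
    qed
    ultimately have "integral {r..s} (\<lambda>t. - 2 * C t) \<le> h s - h r"
      by (rule abs_continuous_curve_increment_ge_integral[OF rs(2)])
    moreover have "integral {r..s} C \<le> E"
      unfolding E_def using integral_subset_le[OF sub integrable_subinterval_real[OF C(1) sub] C(1)] C(2) by blast
    ultimately have "h r \<le> 2 * E + h s" by simp
    then have "exp (h r) \<le> exp (2 * E) * exp (h s)" by (simp flip: exp_add)
    then show ?thesis using pos by (simp add: h_def)
  qed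
  have "Z r \<bullet> Z r \<le> exp (2 * E) * (Z s \<bullet> Z s)"
  proof (rule field_le_epsilon)
    fix e :: real assume "e > 0"
    define e' where "e' = e / exp (2 * E)"
    have "e' > 0" "exp (2 * E) * e' = e" using \<open>e > 0\<close> by (auto simp: e'_def)
    then show "Z r \<bullet> Z r \<le> exp (2 * E) * (Z s \<bullet> Z s) + e"
      using eps[of e'] by (simp add: distrib_left)
  qed
  then have "(norm (Z r))\<^sup>2 \<le> (exp E * norm (Z s))\<^sup>2"
    by (simp add: power_mult_distrib power2_norm_eq_inner flip: exp_double)
  then show ?thesis unfolding Z_def E_def by (rule power2_le_imp_le) simp
qed

text \<open>The inequality passes to limit points of b. With one of v and w fixed it is a half-space
  condition on the other, so it extends to the convex hulls one argument at a time.\<close>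

lemma filippov_hull_one_sided_Lipschitz:
  fixes b :: "real \<Rightarrow> 'a::real_inner \<Rightarrow> 'a"
  assumes osl: "\<And>x y. (b t x - b t y) \<bullet> (x - y) \<ge> - C * (norm (x - y))\<^sup>2"
    and v: "v \<in> filippov_hull b t x" and w: "w \<in> filippov_hull b t y"
  shows "(v - w) \<bullet> (x - y) \<ge> - C * (norm (x - y))\<^sup>2"
proof -
  let ?L = "\<lambda>x. {z. \<exists>y. filterlim y (at x) sequentially \<and> (\<lambda>n. b t (y n)) \<longlonglongrightarrow> z}"
  let ?c = "- C * (norm (x - y))\<^sup>2"
  have lim: "?c \<le> (v - w) \<bullet> (x - y)" if "v \<in> ?L x" "w \<in> ?L y" for v w
  proof -
    obtain p where p: "filterlim p (at x) sequentially" "(\<lambda>n. b t (p n)) \<longlonglongrightarrow> v"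
      using \<open>v \<in> ?L x\<close> by blast
    obtain q where q: "filterlim q (at y) sequentially" "(\<lambda>n. b t (q n)) \<longlonglongrightarrow> w"
      using \<open>w \<in> ?L y\<close> by blast
    have pq: "p \<longlonglongrightarrow> x" "q \<longlonglongrightarrow> y"
      using p(1) q(1) by (auto simp: filterlim_at)
    show ?thesis
    proof (rule LIMSEQ_le)
      show "(\<lambda>n. - C * (norm (p n - q n))\<^sup>2) \<longlonglongrightarrow> ?c" by (intro tendsto_intros pq)
      show "(\<lambda>n. (b t (p n) - b t (q n)) \<bullet> (p n - q n)) \<longlonglongrightarrow> (v - w) \<bullet> (x - y)"
        by (intro tendsto_intros p q pq)
    qed (use osl in blast)
  qed
  have eq: "(v - w) \<bullet> (x - y) = (x - y) \<bullet> v - (x - y) \<bullet> w" for v w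
    by (simp add: inner_diff_left inner_commute)
  have 1: "?c \<le> (v - w) \<bullet> (x - y)" if w: "w \<in> ?L y" for w
  proof -
    have "?L x \<subseteq> {v. (x - y) \<bullet> v \<ge> ?c + (x - y) \<bullet> w}"
    proof
      fix v assume "v \<in> ?L x"
      from lim[OF this w] show "v \<in> {v. (x - y) \<bullet> v \<ge> ?c + (x - y) \<bullet> w}"
        unfolding eq by simp
    qed
    then have "filippov_hull b t x \<subseteq> {v. (x - y) \<bullet> v \<ge> ?c + (x - y) \<bullet> w}"
      unfolding filippov_hull_def by (rule hull_minimal) (rule convex_halfspace_ge)
    then show ?thesis using v unfolding eq by auto
  qed
  have "?L y \<subseteq> {w. (x - y) \<bullet> w \<le> (x - y) \<bullet> v - ?c}"
  proof
    fix w assume "w \<in> ?L y"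
    from 1[OF this] show "w \<in> {w. (x - y) \<bullet> w \<le> (x - y) \<bullet> v - ?c}"
      unfolding eq by simp
  qed
  then have "filippov_hull b t y \<subseteq> {w. (x - y) \<bullet> w \<le> (x - y) \<bullet> v - ?c}"
    unfolding filippov_hull_def by (rule hull_minimal) (rule convex_halfspace_le)
  then show ?thesis using w unfolding eq by auto
qed

subsection \<open>The degree of a linear map\<close>

lemma homotopic_with_canonI:
  assumes "continuous_on ({0..1} \<times> S) (\<lambda>z. H (fst z) (snd z))"
    and "\<And>t x. \<lbrakk>0 \<le> t; t \<le> 1; x \<in> S\<rbrakk> \<Longrightarrow> H t x \<in> T"
    and "\<And>x. x \<in> S \<Longrightarrow> H (0::real) x = f x" and "\<And>x. x \<in> S \<Longrightarrow> H 1 x = g x"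
  shows "homotopic_with_canon (\<lambda>_. True) S T f g"
  using assms by (subst homotopic_with) (auto intro!: exI[of _ "\<lambda>z. H (fst z) (snd z)"])

lemma nsphere_top_of_set: "nsphere n = top_of_set {x. (\<Sum>i\<le>n. (x i)\<^sup>2) = 1 \<and> (\<forall>i>n. x i = 0)}"
  by (simp add: nsphere euclidean_product_topology)

text \<open>Reflection in the hyperplane orthogonal to v. Dividing by \<open>v \<bullet> v\<close>
  spares a normalization, so that v may run along a segment avoiding 0.\<close>

definition householder :: "real^'n::finite \<Rightarrow> real^'n \<Rightarrow> real^'n" where
  "householder v x = x - (2 * (v \<bullet> x) / (v \<bullet> v)) *\<^sub>R v"

lemma norm_householder: "v \<noteq> 0 \<Longrightarrow> norm (householder v x) = norm x"
proof -
  assume "v \<noteq> 0"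
  then have "v \<bullet> v \<noteq> 0" by simp
  then have "householder v x \<bullet> householder v x = x \<bullet> x"
    unfolding householder_def by (simp add: inner_diff_left inner_diff_right inner_commute[of x v] field_simps)
  then show ?thesis by (simp add: norm_eq_sqrt_inner)
qed

definition stretch :: "'n::finite \<Rightarrow> real \<Rightarrow> real^'n \<Rightarrow> real^'n" where
  "stretch j a x = (\<chi> i. (if i = j then a else 1) * x $ i)"

lemma linear_diagonal: "linear (\<lambda>x::real^'n. \<chi> i. c i * x $ i)"
  by (rule linearI) (simp_all add: vec_eq_iff algebra_simps)

lemma inj_diagonal:
  assumes "\<And>i. c i \<noteq> (0::real)"
  shows "inj (\<lambda>x::real^'n. \<chi> i. c i * x $ i)"
  using assms by (auto simp: inj_def vec_eq_iff)

section \<open>Brouwer degree of maps from the unit sphere to the punctured space\<close>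

context
  fixes b :: "nat \<Rightarrow> 'n::finite"
  assumes b: "bij_betw b {..<CARD('n)} UNIV"
begin

text \<open>The points of \<open>nsphere\<close> are sequences indexed by natural numbers, so the
  unit sphere is carried there along an enumeration b of the coordinates. \<open>CARD('n)\<close>
  coordinates give the sphere of dimension \<open>CARD('n) - 1\<close>.\<close>

definition vec_of :: "(nat \<Rightarrow> real) \<Rightarrow> real^'n" where
  "vec_of x = (\<chi> i. x (inv_into {..<CARD('n)} b i))"

definition coords_of :: "real^'n \<Rightarrow> nat \<Rightarrow> real" where
  "coords_of y k = (if k < CARD('n) then y $ b k else 0)"

lemma b_inv: "b (inv_into {..<CARD('n)} b i) = i" "inv_into {..<CARD('n)} b i < CARD('n)"
  using b by (auto simp: bij_betw_def f_inv_into_f inv_into_into[of i b "{..<CARD('n)}", simplified])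

lemma inv_b: "k < CARD('n) \<Longrightarrow> inv_into {..<CARD('n)} b (b k) = k"
  using b by (simp add: bij_betw_def)

lemma vec_of_coords_of [simp]: "vec_of (coords_of y) = y"
  by (simp add: vec_of_def coords_of_def b_inv vec_eq_iff)

lemma coords_of_vec_of: "x \<in> topspace (nsphere (CARD('n) - 1)) \<Longrightarrow> coords_of (vec_of x) = x"
proof
  fix k assume "x \<in> topspace (nsphere (CARD('n) - 1))"
  moreover have "k < CARD('n) \<or> k > CARD('n) - 1" using zero_less_card_finite[where 'a='n] by linarith
  ultimately show "coords_of (vec_of x) k = x k"
    by (auto simp: vec_of_def coords_of_def inv_b nsphere_top_of_set)
qed

lemma sum_coords_of: "(\<Sum>i\<le>CARD('n) - 1. (coords_of y i)\<^sup>2) = (norm y)\<^sup>2"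
proof -
  have "{..CARD('n) - 1} = {..<CARD('n)}" using zero_less_card_finite[where 'a='n] by (auto; linarith)
  then have "(\<Sum>i\<le>CARD('n) - 1. (coords_of y i)\<^sup>2) = (\<Sum>k<CARD('n). (y $ b k)\<^sup>2)"
    by (simp add: coords_of_def)
  also have "\<dots> = (\<Sum>i\<in>UNIV. (y $ i)\<^sup>2)" by (rule sum.reindex_bij_betw[OF b])
  finally show ?thesis by (simp add: norm_vec_def L2_set_def sum_nonneg)
qed

lemma coords_of_in_nsphere: "norm y = 1 \<Longrightarrow> coords_of y \<in> topspace (nsphere (CARD('n) - 1))"
  using sum_coords_of[of y] by (auto simp: nsphere_top_of_set coords_of_def)

lemma norm_vec_of: "x \<in> topspace (nsphere (CARD('n) - 1)) \<Longrightarrow> norm (vec_of x) = 1"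
  using sum_coords_of[of "vec_of x"] coords_of_vec_of[of x]
  by (auto simp: nsphere_top_of_set power2_eq_1_iff) (smt (verit) norm_ge_zero)

lemma continuous_on_vec_of: "continuous_on S vec_of"
  unfolding vec_of_def[abs_def]
  by (intro continuous_on_vec_lambda continuous_on_subset[OF continuous_on_product_coordinates] subset_UNIV)

lemma continuous_on_coords_of: "continuous_on S coords_of"
proof (rule continuous_on_coordinatewise_then_product)
  show "continuous_on S (\<lambda>y. coords_of y k)" for k
    by (cases "k < CARD('n)") (simp_all add: coords_of_def continuous_intros)
qed

text \<open>Radial projection by \<open>sgn\<close> turns a map without zeros on the sphere into a
  self-map of the sphere, so homotopies only have to avoid 0.\<close>

definition sphere_map :: "(real^'n \<Rightarrow> real^'n) \<Rightarrow> (nat \<Rightarrow> real) \<Rightarrow> nat \<Rightarrow> real" where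
  "sphere_map f x = coords_of (sgn (f (vec_of x)))"

definition sphere_degree :: "(real^'n \<Rightarrow> real^'n) \<Rightarrow> int" where
  "sphere_degree f = Brouwer_degree2 (CARD('n) - 1) (sphere_map f)"

lemma sphere_degree_homotopic:
  assumes "homotopic_with_canon (\<lambda>_. True) (sphere 0 1) (UNIV - {0}) f g"
  shows "sphere_degree f = sphere_degree g"
proof -
  let ?p = "CARD('n) - 1"
  have 1: "continuous_map (top_of_set (UNIV - {0})) (nsphere ?p) (\<lambda>y. coords_of (sgn y))"
  proof -
    have "continuous_on (UNIV - {0}) (\<lambda>y::real^'n. sgn y)"
      unfolding sgn_div_norm by (intro continuous_intros) auto
    then have "continuous_on (UNIV - {0}) (\<lambda>y. coords_of (sgn y))"
      by (rule continuous_on_compose2[OF continuous_on_coords_of[of UNIV]]) simp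
    moreover have "coords_of (sgn y) \<in> topspace (nsphere ?p)" if "y \<noteq> 0" for y
      using that by (intro coords_of_in_nsphere) (simp add: norm_sgn)
    ultimately show ?thesis by (auto simp: nsphere_top_of_set)
  qed
  have 2: "continuous_map (nsphere ?p) (top_of_set (sphere 0 1)) vec_of"
    using norm_vec_of by (auto simp: nsphere_top_of_set continuous_on_vec_of)
  have hom: "homotopic_with (\<lambda>_. True) (nsphere ?p) (nsphere ?p) ((\<lambda>y. coords_of (sgn y)) \<circ> (f \<circ> vec_of)) ((\<lambda>y. coords_of (sgn y)) \<circ> (g \<circ> vec_of))"
    by (intro homotopic_with_compose_continuous_map_left[OF _ 1] homotopic_with_compose_continuous_map_right[OF assms 2]) auto
  have eq: "sphere_map k = (\<lambda>y. coords_of (sgn y)) \<circ> (k \<circ> vec_of)" for k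
    by (simp add: fun_eq_iff sphere_map_def)
  show ?thesis
    unfolding sphere_degree_def eq[of f] eq[of g] by (rule Brouwer_degree2_homotopic[OF hom])
qed

lemma sphere_degree_homotopic_segment:
  assumes "continuous_on (sphere 0 1) f" "continuous_on (sphere 0 1) g"
    and "\<And>x u. \<lbrakk>x \<noteq> 0; 0 \<le> u; u \<le> 1\<rbrakk> \<Longrightarrow> (1 - u) *\<^sub>R f x + u *\<^sub>R g x \<noteq> 0"
  shows "sphere_degree f = sphere_degree g"
  using assms by (intro sphere_degree_homotopic homotopic_with_linear) (auto simp: closed_segment_def, metis norm_zero zero_neq_one)

lemma sphere_degree_id [simp]: "sphere_degree (\<lambda>x. x) = 1"
proof -
  have "sphere_degree (\<lambda>x. x) = Brouwer_degree2 (CARD('n) - 1) id"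
    unfolding sphere_degree_def
    by (rule Brouwer_degree2_eq) (simp add: sphere_map_def coords_of_vec_of norm_vec_of sgn_div_norm)
  then show ?thesis by simp
qed

lemma continuous_map_sphere_map:
  assumes "linear f" "inj f"
  shows "continuous_map (nsphere (CARD('n) - 1)) (nsphere (CARD('n) - 1)) (sphere_map f)"
proof -
  have nz: "f (vec_of x) \<noteq> 0" if "x \<in> topspace (nsphere (CARD('n) - 1))" for x
    using norm_vec_of[OF that] assms by (metis linear_injective_0 norm_zero zero_neq_one)
  have "continuous_on (topspace (nsphere (CARD('n) - 1))) (\<lambda>x. sgn (f (vec_of x)))"
    unfolding sgn_div_norm using nz
    by (intro continuous_intros continuous_on_compose2[OF linear_continuous_on[of f UNIV]] continuous_on_vec_of)
       (auto simp: assms linear_linear)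
  then have "continuous_on (topspace (nsphere (CARD('n) - 1))) (sphere_map f)"
    unfolding sphere_map_def[abs_def] by (intro continuous_on_compose2[OF continuous_on_coords_of[of UNIV]]) auto
  moreover have "sphere_map f x \<in> topspace (nsphere (CARD('n) - 1))" if "x \<in> topspace (nsphere (CARD('n) - 1))" for x
    unfolding sphere_map_def using nz[OF that] by (intro coords_of_in_nsphere) (simp add: norm_sgn)
  ultimately show ?thesis
    unfolding nsphere_top_of_set continuous_map_subtopology_eu topspace_euclidean_subtopology by blast
qed

text \<open>The normalization between the two maps is harmless: a linear g pulls out the positive
  factor, and the outer \<open>sgn\<close> discards it.\<close>

lemma sphere_degree_compose:
  assumes f: "linear f" "inj f" and g: "linear g" "inj g"
  shows "sphere_degree (g \<circ> f) = sphere_degree g * sphere_degree f"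
proof -
  have "sphere_degree (g \<circ> f) = Brouwer_degree2 (CARD('n) - 1) (sphere_map g \<circ> sphere_map f)"
    unfolding sphere_degree_def
  proof (rule Brouwer_degree2_eq)
    fix x assume x: "x \<in> topspace (nsphere (CARD('n) - 1))"
    have nz: "f (vec_of x) \<noteq> 0"
      using norm_vec_of[OF x] f by (metis linear_injective_0 norm_zero zero_neq_one)
    have "sgn (g (sgn (f (vec_of x)))) = sgn (g (f (vec_of x)))"
      using nz by (simp add: sgn_div_norm[of "f _"] linear_scale[OF g(1)] sgn_scaleR)
    then show "sphere_map (g \<circ> f) x = (sphere_map g \<circ> sphere_map f) x"
      by (simp add: sphere_map_def)
  qed
  then show ?thesis
    unfolding sphere_degree_def
    using Brouwer_degree2_compose[OF continuous_map_sphere_map[OF f] continuous_map_sphere_map[OF g]] by simp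
qed

text \<open>Moving the vector along a segment that avoids 0 moves the reflection through
  norm-preserving maps, which never send a unit vector to 0.\<close>

lemma sphere_degree_householder_eq:
  assumes "0 \<notin> closed_segment v w"
  shows "sphere_degree (householder v) = sphere_degree (householder w)"
proof (rule sphere_degree_homotopic)
  have nz: "(1 - t) *\<^sub>R v + t *\<^sub>R w \<noteq> 0" if "0 \<le> t" "t \<le> 1" for t
    using assms that by (auto simp: closed_segment_def)
  show "homotopic_with_canon (\<lambda>_. True) (sphere 0 1) (UNIV - {0}) (householder v) (householder w)"
  proof (rule homotopic_with_canonI[where H="\<lambda>t. householder ((1 - t) *\<^sub>R v + t *\<^sub>R w)"])
    show "continuous_on ({0..1} \<times> sphere 0 1) (\<lambda>z. householder ((1 - fst z) *\<^sub>R v + fst z *\<^sub>R w) (snd z))"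
      unfolding householder_def using nz by (auto intro!: continuous_intros)
    show "householder ((1 - t) *\<^sub>R v + t *\<^sub>R w) x \<in> UNIV - {0}" if "0 \<le> t" "t \<le> 1" "x \<in> sphere 0 1" for t x
      using norm_householder[OF nz[OF that(1,2)], of x] that(3) by auto
  qed simp_all
qed

text \<open>The index 0 enumerates the coordinate \<open>b 0\<close>, so in coordinates this
  reflection negates entry 0 only, and for that map the Brouwer degree is known.\<close>

lemma sphere_degree_householder_b0: "sphere_degree (householder (axis (b 0) 1)) = -1"
proof -
  have "sphere_degree (householder (axis (b 0) 1)) = Brouwer_degree2 (CARD('n) - 1) (\<lambda>x i. if i = 0 then - x i else x i)"
    unfolding sphere_degree_def
  proof (rule Brouwer_degree2_eq)
    fix x assume x: "x \<in> topspace (nsphere (CARD('n) - 1))"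
    let ?y = "vec_of x"
    have "norm (householder (axis (b 0) 1) ?y) = 1"
      using norm_vec_of[OF x] by (simp add: norm_householder axis_eq_0_iff)
    then have "sphere_map (householder (axis (b 0) 1)) x = coords_of (householder (axis (b 0) 1) ?y)"
      by (simp add: sphere_map_def sgn_div_norm)
    also have "\<dots> = (\<lambda>i. if i = 0 then - x i else x i)"
    proof
      fix i
      have bi: "b i = b 0 \<longleftrightarrow> i = 0" if "i < CARD('n)"
        using that b by (auto simp: bij_betw_def inj_on_def)
      have "householder (axis (b 0) 1) ?y = ?y - (2 * ?y $ b 0) *\<^sub>R axis (b 0) 1"
        by (simp add: householder_def inner_axis' inner_axis_axis)
      moreover have "coords_of ?y i = x i" using coords_of_vec_of[OF x] by simp
      ultimately show "coords_of (householder (axis (b 0) 1) ?y) i = (if i = 0 then - x i else x i)"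
        using bi by (auto simp: coords_of_def axis_def)
    qed
    finally show "sphere_map (householder (axis (b 0) 1)) x = (\<lambda>i. if i = 0 then - x i else x i)" .
  qed
  then show ?thesis by (simp add: Brouwer_degree2_reflection)
qed

text \<open>Both v and -v define the same reflection, and one of them has nonnegative coordinate
  \<open>b 0\<close>; the segment from it to the axis vector misses 0.\<close>

lemma sphere_degree_householder:
  assumes "v \<noteq> 0"
  shows "sphere_degree (householder v) = -1"
proof -
  let ?e = "axis (b 0) 1 :: real^'n"
  have seg: "0 \<notin> closed_segment v ?e" if "v $ b 0 \<ge> 0" "v \<noteq> 0" for v
  proof
    assume "0 \<in> closed_segment v ?e"
    then obtain u where u: "0 \<le> u" "u \<le> 1" "(1 - u) *\<^sub>R v + u *\<^sub>R ?e = 0" by (auto simp: closed_segment_def)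
    then have "(1 - u) * v $ b 0 + u = 0" by (simp add: vec_eq_iff axis_def split: if_splits)
    moreover have "(1 - u) * v $ b 0 \<ge> 0" using u that by simp
    ultimately have "u = 0" using u by linarith
    then show False using u that by simp
  qed
  have neg: "householder (- v) = householder v"
    by (simp add: householder_def[abs_def])
  show ?thesis
  proof (cases "v $ b 0 \<ge> 0")
    case True
    then show ?thesis using sphere_degree_householder_eq[OF seg] assms sphere_degree_householder_b0 by simp
  next
    case False
    then show ?thesis using sphere_degree_householder_eq[OF seg, of "- v"] assms sphere_degree_householder_b0 neg by simp
  qed
qed

lemma sphere_degree_stretch_cong:
  assumes "0 < a * a'"
  shows "sphere_degree (stretch j a) = sphere_degree (stretch j a')"
proof -
  have cont: "continuous_on S (stretch j a)" for S a
    unfolding stretch_def by (intro linear_continuous_on linear_diagonal[THEN linear_conv_bounded_linear[THEN iffD1]])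
  show ?thesis
  proof (rule sphere_degree_homotopic_segment[OF cont cont])
    fix x :: "real^'n" and u :: real
    assume x: "x \<noteq> 0" and u: "0 \<le> u" "u \<le> 1"
    have "(1 - u) * a + u * a' \<noteq> 0"
    proof
      assume eq: "(1 - u) * a + u * a' = 0"
      \<comment> \<open>Multiplied by a, the vanishing combination becomes a sum of nonnegative
        terms, one of them positive.\<close>
      have "a * a > 0" "0 \<le> a * a'" using assms less_imp_le[OF assms] by (auto simp: zero_less_mult_iff)
      then have "0 \<le> (1 - u) * (a * a)" "0 \<le> u * (a * a')" "0 < (1 - u) * (a * a) \<or> 0 < u * (a * a')"
        using u assms by (auto intro!: mult_nonneg_nonneg mult_pos_pos simp: le_less)
      moreover have "(1 - u) * (a * a) + u * (a * a') = 0"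
        using eq by (metis (no_types, opaque_lifting) distrib_left mult.left_commute mult_zero_right)
      ultimately show False by linarith
    qed
    moreover have "(1 - u) *\<^sub>R stretch j a x + u *\<^sub>R stretch j a' x = stretch j ((1 - u) * a + u * a') x"
      by (simp add: stretch_def vec_eq_iff algebra_simps)
    ultimately show "(1 - u) *\<^sub>R stretch j a x + u *\<^sub>R stretch j a' x \<noteq> 0"
      using x by (auto simp: stretch_def vec_eq_iff)
  qed
qed

lemma sphere_degree_stretch:
  assumes "a \<noteq> 0"
  shows "real_of_int (sphere_degree (stretch j a)) = sgn a"
proof (cases "a > 0")
  case True
  have "stretch j 1 = (\<lambda>x. x)" by (simp add: stretch_def fun_eq_iff vec_eq_iff)
  then show ?thesis using True sphere_degree_stretch_cong[of a 1 j] by simp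
next
  case False
  have "householder (axis j 1) x = x - (2 * x $ j) *\<^sub>R axis j 1" for x
    by (simp add: householder_def inner_axis' inner_axis_axis)
  then have "stretch j (-1) = householder (axis j 1)"
    by (auto simp: stretch_def fun_eq_iff vec_eq_iff axis_def)
  then show ?thesis
    using False assms sphere_degree_stretch_cong[of a "-1" j] sphere_degree_householder[of "axis j 1"]
    by (simp add: axis_eq_0_iff)
qed

lemma sphere_degree_diagonal:
  assumes "\<And>i. c i \<noteq> (0::real)"
  shows "real_of_int (sphere_degree (\<lambda>x. \<chi> i. c i * x $ i)) = sgn (\<Prod>i\<in>UNIV. c i)"
proof -
  have "real_of_int (sphere_degree (\<lambda>x. \<chi> i. (if i \<in> S then c i else 1) * x $ i)) = sgn (\<Prod>i\<in>S. c i)"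
    if "finite S" for S
    using that
  proof induction
    case (insert j S)
    have "(\<lambda>x. \<chi> i. (if i \<in> insert j S then c i else 1) * x $ i)
       = (\<lambda>x. \<chi> i. (if i \<in> S then c i else 1) * x $ i) \<circ> stretch j (c j)"
      using insert.hyps by (auto simp: fun_eq_iff vec_eq_iff stretch_def)
    then have "sphere_degree (\<lambda>x. \<chi> i. (if i \<in> insert j S then c i else 1) * x $ i)
       = sphere_degree ((\<lambda>x. \<chi> i. (if i \<in> S then c i else 1) * x $ i) \<circ> stretch j (c j))"
      by (rule arg_cong)
    also have "\<dots> = sphere_degree (\<lambda>x. \<chi> i. (if i \<in> S then c i else 1) * x $ i) * sphere_degree (stretch j (c j))"
      unfolding stretch_def by (intro sphere_degree_compose linear_diagonal inj_diagonal) (simp_all add: assms)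
    finally show ?case using insert by (simp add: sphere_degree_stretch assms sgn_mult)
  qed (simp add: vec_lambda_eta)
  from this[of UNIV] show ?thesis by simp
qed

end

text \<open>Both sides are multiplicative, so elementary maps suffice: diagonal maps,
  transpositions, which are reflections, and shears, which are homotopic to the identity.
  Injectivity is a premise inside the induction because the induction also passes through singular
  maps.\<close>

lemma sphere_degree_linear:
  fixes b :: "nat \<Rightarrow> 'n::finite" and f :: "real^'n \<Rightarrow> real^'n"
  assumes b: "bij_betw b {..<CARD('n)} UNIV" and "linear f" "inj f"
  shows "real_of_int (sphere_degree b f) = sgn (det (matrix f))"
proof -
  have "inj f \<longrightarrow> real_of_int (sphere_degree b f) = sgn (det (matrix f))"
    using \<open>linear f\<close>
  proof (rule induct_linear_elementary)
    fix f g :: "real^'n \<Rightarrow> real^'n"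
    assume lin: "linear f" "linear g"
      and IH: "inj f \<longrightarrow> real_of_int (sphere_degree b f) = sgn (det (matrix f))"
        "inj g \<longrightarrow> real_of_int (sphere_degree b g) = sgn (det (matrix g))"
    show "inj (f \<circ> g) \<longrightarrow> real_of_int (sphere_degree b (f \<circ> g)) = sgn (det (matrix (f \<circ> g)))"
    proof
      assume "inj (f \<circ> g)"
      then have "inj g" by (rule inj_on_imageI2)
      \<comment> \<open>Injectivity of the outer factor is not formal; it comes from
        multiplicativity of the determinant.\<close>
      have "det (matrix (f \<circ> g)) \<noteq> 0"
        using det_nz_iff_inj[OF linear_compose[OF lin(2,1)]] \<open>inj (f \<circ> g)\<close> by blast
      then have "det (matrix f) \<noteq> 0"
        by (auto simp: matrix_compose[OF lin(2,1)] det_mul)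
      then have "inj f" using det_nz_iff_inj[OF lin(1)] by blast
      show "real_of_int (sphere_degree b (f \<circ> g)) = sgn (det (matrix (f \<circ> g)))"
        using IH \<open>inj f\<close> \<open>inj g\<close>
        by (simp add: sphere_degree_compose[OF b lin(2) _ lin(1)] matrix_compose[OF lin(2,1)] det_mul sgn_mult)
    qed
  next
    fix f :: "real^'n \<Rightarrow> real^'n" and i
    assume "linear f" and zero: "\<And>x. f x $ i = 0"
    have "\<not> surj f"
    proof
      assume "surj f"
      then obtain x where "axis i 1 = f x" by (rule surjE)
      then have "axis i (1::real) $ i = 0" by (simp add: zero)
      then show False by (simp add: axis_def)
    qed
    then show "inj f \<longrightarrow> real_of_int (sphere_degree b f) = sgn (det (matrix f))"
      using linear_injective_imp_surjective[OF \<open>linear f\<close>] by blast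
  next
    fix c :: "'n \<Rightarrow> real"
    let ?f = "\<lambda>x::real^'n. \<chi> i. c i * x $ i"
    have det: "det (matrix ?f) = (\<Prod>i\<in>UNIV. c i)"
      by (simp add: axis_def matrix_def det_diagonal)
    show "inj ?f \<longrightarrow> real_of_int (sphere_degree b ?f) = sgn (det (matrix ?f))"
    proof
      assume "inj ?f"
      then have "det (matrix ?f) \<noteq> 0" using det_nz_iff_inj[OF linear_diagonal[of c]] by simp
      then show "real_of_int (sphere_degree b ?f) = sgn (det (matrix ?f))"
        unfolding det by (intro sphere_degree_diagonal[OF b]) auto
    qed
  next
    fix m n :: 'n assume mn: "m \<noteq> n"
    let ?f = "\<lambda>x::real^'n. \<chi> i. x $ Transposition.transpose m n i"
    \<comment> \<open>Exchanging coordinates m and n is the reflection that negates the difference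
      of the two axis vectors.\<close>
    let ?v = "axis m 1 - axis n 1 :: real^'n"
    have nz: "?v \<noteq> 0" using mn by (simp add: axis_eq_axis)
    have "?v \<bullet> ?v = 2" using mn by (simp add: inner_diff_left inner_diff_right inner_axis_axis)
    then have "householder ?v x = x - (x $ m - x $ n) *\<^sub>R ?v" for x
      by (simp add: householder_def inner_diff_left inner_axis')
    then have "?f x = householder ?v x" for x
      using mn by (auto simp: vec_eq_iff axis_def Transposition.transpose_def)
    then have "?f = householder ?v" by blast
    then have "sphere_degree b ?f = -1" using sphere_degree_householder[OF b nz] by simp
    moreover have "matrix ?f = transpose (\<chi> i j. mat 1 $ i $ Transposition.transpose m n j)"
      by (auto simp: vec_eq_iff transpose_def axis_def mat_def matrix_def)
    then have "det (matrix ?f) = -1"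
      using mn by (simp add: det_permute_columns permutes_swap_id sign_swap_id)
    ultimately show "inj ?f \<longrightarrow> real_of_int (sphere_degree b ?f) = sgn (det (matrix ?f))" by simp
  next
    fix m n :: 'n assume mn: "m \<noteq> n"
    let ?f = "\<lambda>x::real^'n. \<chi> i. if i = m then x $ m + x $ n else x $ i"
    have lin: "linear ?f" by (rule linearI) (auto simp: vec_eq_iff algebra_simps)
    have "sphere_degree b (\<lambda>x. x) = sphere_degree b ?f"
    proof (rule sphere_degree_homotopic_segment[OF b])
      fix x :: "real^'n" and u :: real
      assume "x \<noteq> 0"
      show "(1 - u) *\<^sub>R x + u *\<^sub>R ?f x \<noteq> 0"
      proof
        assume eq: "(1 - u) *\<^sub>R x + u *\<^sub>R ?f x = 0"
        have "x $ i = 0" if "i \<noteq> m" for i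
          using arg_cong[OF eq, of "\<lambda>y. y $ i"] that by (simp add: algebra_simps)
        moreover from this[of n] have "x $ m = 0"
          using arg_cong[OF eq, of "\<lambda>y. y $ m"] mn by (simp add: algebra_simps)
        ultimately have "x = 0" by (metis vec_eq_iff zero_index)
        then show False using \<open>x \<noteq> 0\<close> by simp
      qed
    qed (use lin in \<open>auto simp: linear_linear intro!: linear_continuous_on\<close>)
    moreover have "det (matrix ?f) = 1"
    proof -
      have "matrix ?f = (\<chi> k. if k = m then row m (mat 1) + 1 *s row n (mat 1) else row k (mat 1))"
        by (auto simp: matrix_def axis_def row_def mat_def vec_eq_iff)
      then show ?thesis using det_row_operation[OF mn, of "mat 1" 1] by (simp add: det_I)
    qed
    ultimately show "inj ?f \<longrightarrow> real_of_int (sphere_degree b ?f) = sgn (det (matrix ?f))"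
      by (simp add: sphere_degree_id[OF b])
  qed
  then show ?thesis using \<open>inj f\<close> by blast
qed

theorem det_pos_if_homotopic_id:
  fixes f :: "real^'n::finite \<Rightarrow> real^'n"
  assumes "linear f" "inj f"
    and "homotopic_with_canon (\<lambda>_. True) (sphere 0 1) (UNIV - {0}) (\<lambda>x. x) f"
  shows "det (matrix f) > 0"
proof -
  obtain b :: "nat \<Rightarrow> 'n" where b: "bij_betw b {..<CARD('n)} UNIV"
    using ex_bij_betw_nat_finite[of "UNIV :: 'n set"] by (auto simp: lessThan_atLeast0)
  have "sgn (det (matrix f)) = 1"
    using sphere_degree_homotopic[OF b assms(3)] sphere_degree_linear[OF b assms(1,2)] sphere_degree_id[OF b] by simp
  then show ?thesis by (simp add: sgn_1_pos)
qed

subsection \<open>Change of variables for Lipschitz maps\<close>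

lemma AE_lebesgue_imp_negligible:
  assumes "AE x in lebesgue. P (x::'a::euclidean_space)"
  shows "negligible {x. \<not> P x}"
proof -
  obtain N where N: "\<And>x. x \<in> space lebesgue - N \<Longrightarrow> P x" "N \<in> null_sets lebesgue"
    by (rule AE_E3[OF assms]) (rule that)
  have "{x. \<not> P x} \<subseteq> N" using N(1) by auto
  then show ?thesis using N(2) by (metis negligible_iff_null_sets negligible_subset)
qed

text \<open>Near a point with injective derivative the map expands distances up to a constant, so that it
  has locally a Lipschitz inverse.\<close>
lemma negligible_vimage_injective_derivative:
  fixes \<Phi> :: "'a::euclidean_space \<Rightarrow> 'a"
  assumes N: "negligible N"
  shows "negligible {x. \<Phi> x \<in> N \<and> (\<exists>f'. (\<Phi> has_derivative f') (at x) \<and> inj f')}"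
proof -
  \<comment> \<open>A countable exhaustion: the single n serves both as expansion constant and as
    inverse radius, uniformly over the points of \<open>E n\<close>.\<close>
  define E where "E n = {x. \<Phi> x \<in> N \<and> (\<forall>y. norm (y - x) < inverse (real (Suc n)) \<longrightarrow>
     norm (y - x) \<le> real (Suc n) * norm (\<Phi> y - \<Phi> x))}" for n
  have "negligible (E n)" for n
    unfolding locally_negligible_alt[of "E n"]
  proof
    fix x assume x: "x \<in> E n"
    \<comment> \<open>Half the radius, so that any two points of the ball are close enough for the
      expansion estimate.\<close>
    define r where "r = inverse (real (Suc n)) / 2"
    define P where "P = E n \<inter> ball x r"
    have "r > 0" by (simp add: r_def)
    have near: "norm (v - u) \<le> real (Suc n) * norm (\<Phi> v - \<Phi> u)" if "u \<in> P" "v \<in> P" for u v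
    proof -
      have "norm (v - u) < inverse (real (Suc n))"
        using that dist_triangle_half_r[of x v "inverse (real (Suc n))" u]
        by (simp add: P_def r_def dist_norm[of v u, symmetric] dist_commute)
      then show ?thesis using that(1) by (simp add: P_def E_def)
    qed
    have inj: "inj_on \<Phi> P"
    proof (rule inj_onI)
      fix u v assume "u \<in> P" "v \<in> P" "\<Phi> u = \<Phi> v"
      then show "u = v" using near[of u v] by simp
    qed
    have "negligible (\<Phi> ` P)"
      by (rule negligible_subset[OF N]) (auto simp: P_def E_def)
    then have "negligible (inv_into P \<Phi> ` \<Phi> ` P)"
    proof (rule negligible_locally_Lipschitz_image[OF order_refl])
      fix u assume u: "u \<in> \<Phi> ` P"
      have "norm (inv_into P \<Phi> v - inv_into P \<Phi> u) \<le> real (Suc n) * norm (v - u)" if "v \<in> \<Phi> ` P" for v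
        using near[of "inv_into P \<Phi> u" "inv_into P \<Phi> v"] u that
        by (simp add: inv_into_into f_inv_into_f)
      then show "\<exists>T B. open T \<and> u \<in> T \<and> (\<forall>v\<in>\<Phi> ` P \<inter> T. norm (inv_into P \<Phi> v - inv_into P \<Phi> u) \<le> B * norm (v - u))"
        by (intro exI[of _ UNIV] exI[of _ "real (Suc n)"]) auto
    qed
    then have "negligible P" using inj by (simp add: inv_into_image_cancel)
    moreover have "openin (top_of_set (E n)) P" "x \<in> P"
      using x \<open>r > 0\<close> by (auto simp: P_def)
    ultimately show "\<exists>U. openin (top_of_set (E n)) U \<and> x \<in> U \<and> negligible U" by blast
  qed
  then have "negligible (\<Union>n. E n)" by (intro negligible_countable_Union) auto
  moreover have "{x. \<Phi> x \<in> N \<and> (\<exists>f'. (\<Phi> has_derivative f') (at x) \<and> inj f')} \<subseteq> (\<Union>n. E n)"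
  proof clarify
    fix x f' assume x: "\<Phi> x \<in> N" and f': "(\<Phi> has_derivative f') (at x)" "inj f'"
    obtain c where c: "c > 0" "\<And>h. c * norm h \<le> norm (f' h)"
      using linear_inj_bounded_below_pos[OF has_derivative_linear[OF f'(1)] f'(2)] by (metis mult.commute)
    obtain d where d: "d > 0" "\<And>y. norm (y - x) < d \<Longrightarrow> norm (\<Phi> y - \<Phi> x - f' (y - x)) \<le> c / 2 * norm (y - x)"
      using f'(1) c(1) unfolding has_derivative_at_alt by (meson half_gt_zero)
    \<comment> \<open>The linearization error uses up half of the lower bound c, so expansion by
      \<open>c / 2\<close> remains on the ball of radius d; n is chosen to meet both
      constants.\<close>
    obtain n where n: "inverse (real (Suc n)) < min d (c / 2)"
      using reals_Archimedean[of "min d (c / 2)"] d(1) c(1) by auto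
    have "norm (y - x) \<le> real (Suc n) * norm (\<Phi> y - \<Phi> x)" if "norm (y - x) < inverse (real (Suc n))" for y
    proof -
      have "norm (f' (y - x)) \<le> norm (\<Phi> y - \<Phi> x) + norm (\<Phi> y - \<Phi> x - f' (y - x))"
        using norm_triangle_ineq4[of "\<Phi> y - \<Phi> x" "\<Phi> y - \<Phi> x - f' (y - x)"] by simp
      then have "c / 2 * norm (y - x) \<le> norm (\<Phi> y - \<Phi> x)"
        using d(2)[of y] that n c(2)[of "y - x"] by simp
      moreover have "inverse (real (Suc n)) * norm (y - x) \<le> c / 2 * norm (y - x)"
        using n by (intro mult_right_mono) auto
      ultimately have "inverse (real (Suc n)) * norm (y - x) \<le> norm (\<Phi> y - \<Phi> x)" by linarith
      then show ?thesis by (simp add: field_simps)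
    qed
    then have "x \<in> E n" using x by (simp add: E_def)
    then show "x \<in> (\<Union>n. E n)" by blast
  qed
  ultimately show ?thesis by (rule negligible_subset)
qed

text \<open>The real-valued case of the vector-valued formula, obtained by identifying reals with
  \<open>real^1\<close>.\<close>

lemma has_absolute_integral_change_of_variables_scalar:
  fixes f :: "real^'n::{finite,wellorder} \<Rightarrow> real" and g :: "real^'n::_ \<Rightarrow> real^'n::_"
  assumes "S \<in> sets lebesgue" "\<And>x. x \<in> S \<Longrightarrow> (g has_derivative g' x) (at x within S)" "inj_on g S"
  shows "(\<lambda>x. \<bar>det (matrix (g' x))\<bar> * f (g x)) absolutely_integrable_on S \<and>
           integral S (\<lambda>x. \<bar>det (matrix (g' x))\<bar> * f (g x)) = b
     \<longleftrightarrow> f absolutely_integrable_on (g ` S) \<and> integral (g ` S) f = b"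
proof -
  have "(\<lambda>x. \<bar>det (matrix (g' x))\<bar> *\<^sub>R (vec (f (g x)) :: real^1)) absolutely_integrable_on S \<and>
           integral S (\<lambda>x. \<bar>det (matrix (g' x))\<bar> *\<^sub>R (vec (f (g x)) :: real^1)) = vec b
     \<longleftrightarrow> (\<lambda>x. vec (f x) :: real^1) absolutely_integrable_on (g ` S) \<and> integral (g ` S) (\<lambda>x. vec (f x)) = (vec b :: real^1)"
    by (rule has_absolute_integral_change_of_variables[OF assms])
  then show ?thesis
    by (simp add: absolutely_integrable_on_1_iff integral_on_1_eq vec_eq_iff)
qed

text \<open>The preimage of an open set exceeds its interior by points of discontinuity only. These
  are null, and Lebesgue measure is complete.\<close>

lemma AE_continuous_lebesgue_measurable:
  fixes \<psi> :: "'a::euclidean_space \<Rightarrow> 'b::topological_space"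
  assumes "AE y in lebesgue. isCont \<psi> y"
  shows "\<psi> \<in> lebesgue \<rightarrow>\<^sub>M borel"
proof (rule borel_measurableI)
  fix U :: "'b set" assume "open U"
  have "{y. \<not> isCont \<psi> y} \<in> null_sets lebesgue"
    using AE_lebesgue_imp_negligible[OF assms] by (simp add: negligible_iff_null_sets)
  then obtain N where N: "N \<in> null_sets lebesgue" "\<And>y. y \<notin> N \<Longrightarrow> isCont \<psi> y"
    by blast
  have "\<psi> -` U - interior (\<psi> -` U) \<subseteq> N"
  proof
    fix y assume y: "y \<in> \<psi> -` U - interior (\<psi> -` U)"
    show "y \<in> N"
    proof (rule ccontr)
      assume "y \<notin> N"
      then obtain V where "open V" "y \<in> V" "\<forall>z\<in>V. \<psi> z \<in> U"
        using N(2) \<open>open U\<close> y unfolding continuous_at_open by blast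
      then have "y \<in> interior (\<psi> -` U)" by (auto simp: interior_def)
      then show False using y by blast
    qed
  qed
  then have "\<psi> -` U - interior (\<psi> -` U) \<in> sets lebesgue"
    using N(1) by (meson completion.complete null_setsD2 null_sets_subset)
  moreover have "interior (\<psi> -` U) \<in> sets lebesgue" by simp
  ultimately have "interior (\<psi> -` U) \<union> (\<psi> -` U - interior (\<psi> -` U)) \<in> sets lebesgue" by blast
  moreover have "interior (\<psi> -` U) \<union> (\<psi> -` U - interior (\<psi> -` U)) = \<psi> -` U" using interior_subset by blast
  ultimately show "\<psi> -` U \<inter> space lebesgue \<in> sets lebesgue" by simp
qed

text \<open>As \<Phi> may collapse sets of positive measure to null sets,
  \<open>f (\<Phi> x)\<close> alone need not be measurable. The product with the Jacobian is
  therefore never treated factor by factor: its integrability is read off from the change of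
  variables on S and carried to A, since it vanishes almost everywhere on A outside S.\<close>

theorem Lipschitz_pushforward_of_right_inverse:
  fixes \<Phi> \<psi> :: "real^'n::{finite,wellorder} \<Rightarrow> real^'n::_" and f :: "real^'n::_ \<Rightarrow> real"
  assumes Lip: "B-lipschitz_on UNIV \<Phi>"
    and diff: "AE x in lebesgue. \<Phi> differentiable at x"
    and pos: "AE x in lebesgue. \<Phi> differentiable at x \<longrightarrow> det (jacobian \<Phi> (at x)) \<ge> 0"
    and fib: "AE y in lebesgue. \<Phi> -` {y} = {\<psi> y}"
    and \<psi>: "\<psi> \<in> lebesgue \<rightarrow>\<^sub>M borel"
    and f: "\<And>K. compact K \<Longrightarrow> set_integrable lebesgue K f"
    and A: "A \<in> sets borel" "bounded A"
  shows "set_integrable lebesgue (\<psi> -` A) f"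
    and "set_integrable lebesgue A (\<lambda>x. f (\<Phi> x) * det (jacobian \<Phi> (at x)))"
    and "(LINT x:A|lebesgue. f (\<Phi> x) * det (jacobian \<Phi> (at x))) = (LINT y:\<psi> -` A|lebesgue. f y)"
proof -
  define D where "D = {x. \<Phi> differentiable at x}"
  define J where "J x = det (jacobian \<Phi> (at x))" for x
  define Y where "Y = {y. \<Phi> -` {y} = {\<psi> y}}"
  define W where "W = \<psi> -` A"
  have Dn: "negligible (- D)" and Yn: "negligible (- Y)" and Jn: "negligible {x. x \<in> D \<and> J x < 0}"
    using AE_lebesgue_imp_negligible[OF diff] AE_lebesgue_imp_negligible[OF fib] AE_lebesgue_imp_negligible[OF pos]
    by (simp_all add: D_def Y_def J_def not_le Compl_eq)
  have W: "W \<in> sets lebesgue" using measurable_sets[OF \<psi> A(1)] by (simp add: W_def)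
  have YD: "\<psi> (\<Phi> x) = x" if "\<Phi> x \<in> Y" for x
  proof -
    have "x \<in> \<Phi> -` {\<Phi> x}" by simp
    also have "\<dots> = {\<psi> (\<Phi> x)}" using that unfolding Y_def by (rule CollectD)
    finally show ?thesis by simp
  qed
  have Y\<psi>: "\<Phi> (\<psi> y) = y" if "y \<in> Y" for y
    using that unfolding Y_def by blast
  have der: "(\<Phi> has_derivative frechet_derivative \<Phi> (at x)) (at x within S)" if "x \<in> D" for x S
    using that frechet_derivative_works has_derivative_at_withinI unfolding D_def by blast
  have J_eq: "J x = det (matrix (frechet_derivative \<Phi> (at x)))" for x
    by (simp add: J_def jacobian_def)
  have lin: "linear (frechet_derivative \<Phi> (at x))" if "x \<in> D" for x
    using der[OF that, of UNIV] by (rule has_derivative_linear)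
  have bad: "negligible {x \<in> D. J x \<noteq> 0 \<and> \<Phi> x \<notin> Y}"
  proof (rule negligible_subset[OF negligible_vimage_injective_derivative[OF Yn, of \<Phi>]])
    show "{x \<in> D. J x \<noteq> 0 \<and> \<Phi> x \<notin> Y} \<subseteq> {x. \<Phi> x \<in> - Y \<and> (\<exists>f'. (\<Phi> has_derivative f') (at x) \<and> inj f')}"
      using der[where S=UNIV] det_nz_iff_inj[OF lin] by (auto simp: J_eq)
  qed
  define S where "S = {x \<in> A \<inter> D. J x \<noteq> 0 \<and> \<Phi> x \<in> Y}"
  have Dm: "D \<in> sets lebesgue"
    using Dn by (metis Compl_in_sets_lebesgue negligible_imp_sets)
  have Am: "A \<in> sets lebesgue" using A(1) by simp
  have Sm: "S \<in> sets lebesgue"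
  proof -
    have "J \<in> borel_measurable (lebesgue_on D)"
      unfolding J_eq[abs_def] by (rule borel_measurable_det_Jacobian[OF Dm der])
    then have "J -` (- {0}) \<inter> space (lebesgue_on D) \<in> sets (lebesgue_on D)"
      by (rule measurable_sets) auto
    then have "J -` (- {0}) \<inter> D \<in> sets lebesgue"
      using Dm by (simp add: sets_restrict_space_iff)
    moreover have "{x \<in> D. J x \<noteq> 0 \<and> \<Phi> x \<notin> Y} \<in> sets lebesgue" using bad by (rule negligible_imp_sets)
    moreover have "S = A \<inter> (J -` (- {0}) \<inter> D) - {x \<in> D. J x \<noteq> 0 \<and> \<Phi> x \<notin> Y}"
      by (auto simp: S_def)
    ultimately show ?thesis using Am by auto
  qed
  have inj: "inj_on \<Phi> S" by (rule inj_onI) (metis (mono_tags, lifting) S_def YD mem_Collect_eq)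
  have Lip_neg: "negligible (\<Phi> ` X)" if "negligible X" for X
    using that
    by (rule negligible_locally_Lipschitz_image[OF order_refl])
       (use lipschitz_onD[OF Lip] in \<open>auto simp: dist_norm intro!: exI[of _ UNIV] exI[of _ B]\<close>)
  have Sard: "negligible (\<Phi> ` {x \<in> D. J x = 0})"
  proof (rule baby_Sard[OF order_refl])
    show "rank (matrix (frechet_derivative \<Phi> (at x))) < CARD('n)" if "x \<in> {x \<in> D. J x = 0}" for x
      using that det_eq_0_rank[of "matrix (frechet_derivative \<Phi> (at x))"] by (simp add: J_eq)
  qed (use der in auto)
  have sub1: "\<Phi> ` S \<subseteq> W"
    using YD by (force simp: S_def W_def)
  \<comment> \<open>For y in Y the point \<open>\<psi> y\<close> is a preimage in A. If it is not in
    S, it is a point of non-differentiability or of zero Jacobian, and \<Phi> maps both kinds into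
    null sets.\<close>
  have sub2: "W - \<Phi> ` S \<subseteq> - Y \<union> \<Phi> ` (- D) \<union> \<Phi> ` {x \<in> D. J x = 0}"
  proof
    fix y assume y: "y \<in> W - \<Phi> ` S"
    show "y \<in> - Y \<union> \<Phi> ` (- D) \<union> \<Phi> ` {x \<in> D. J x = 0}"
    proof (cases "y \<in> Y")
      case True
      have eq: "\<Phi> (\<psi> y) = y" using Y\<psi>[OF True] .
      have "\<psi> y \<notin> S"
      proof
        assume "\<psi> y \<in> S"
        then have "\<Phi> (\<psi> y) \<in> \<Phi> ` S" by (rule imageI)
        then show False using y eq by simp
      qed
      moreover have "\<psi> y \<in> A" using y by (simp add: W_def)
      ultimately have "\<psi> y \<in> - D \<or> \<psi> y \<in> {x \<in> D. J x = 0}"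
        using True eq by (simp add: S_def)
      then have "\<Phi> (\<psi> y) \<in> \<Phi> ` (- D) \<union> \<Phi> ` {x \<in> D. J x = 0}" by blast
      then show ?thesis unfolding eq by blast
    qed simp
  qed
  have Wneg: "negligible (W - \<Phi> ` S)"
    by (rule negligible_subset[OF _ sub2]) (intro negligible_Un Yn Lip_neg Dn Sard)
  \<comment> \<open>W itself need not be bounded, but up to a null set it lies in the image of A
    under \<Phi>, which is bounded because \<Phi> is Lipschitz.\<close>
  have fW: "set_integrable lebesgue W f"
  proof -
    have "bounded (\<Phi> ` A)"
      using A(2) Lip by (meson bounded_uniformly_continuous_image lipschitz_on_uniformly_continuous lipschitz_on_subset subset_UNIV)
    then have K: "compact (closure (\<Phi> ` A))" by (simp add: compact_closure)
    have "set_integrable lebesgue (W \<inter> closure (\<Phi> ` A)) f"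
      using W by (intro set_integrable_subset[OF f[OF K]]) auto
    moreover have "negligible {y \<in> W \<inter> closure (\<Phi> ` A) - W. f y \<noteq> 0}"
      by (rule negligible_subset[OF negligible_empty]) auto
    moreover have "negligible {y \<in> W - W \<inter> closure (\<Phi> ` A). f y \<noteq> 0}"
    proof (rule negligible_subset[OF Yn], rule subsetI)
      fix y assume y: "y \<in> {y \<in> W - W \<inter> closure (\<Phi> ` A). f y \<noteq> 0}"
      then have "\<psi> y \<in> A" by (simp add: W_def)
      then have "\<Phi> (\<psi> y) \<in> closure (\<Phi> ` A)" by (intro subsetD[OF closure_subset] imageI)
      then show "y \<in> - Y" using y Y\<psi>[of y] by auto
    qed
    ultimately show ?thesis by (rule absolutely_integrable_spike_set)
  qed
  have n1: "negligible {y \<in> W - \<Phi> ` S. f y \<noteq> 0}"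
    by (rule negligible_subset[OF Wneg]) auto
  have n2: "negligible {y \<in> \<Phi> ` S - W. f y \<noteq> 0}"
    by (rule negligible_subset[OF negligible_empty]) (use sub1 in auto)
  have fS: "f absolutely_integrable_on (\<Phi> ` S)"
    by (rule absolutely_integrable_spike_set[OF fW n1 n2])
  have iS: "integral (\<Phi> ` S) f = integral W f"
    by (rule integral_spike_set[OF n2 n1])
  have SD: "x \<in> D" if "x \<in> S" for x using that by (simp add: S_def)
  have absS: "(\<lambda>x. \<bar>J x\<bar> * f (\<Phi> x)) absolutely_integrable_on S"
    and intS: "integral S (\<lambda>x. \<bar>J x\<bar> * f (\<Phi> x)) = integral W f"
    using has_absolute_integral_change_of_variables_scalar[OF Sm der[OF SD] inj, of f "integral W f"] fS iS
    unfolding J_eq by blast+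
  have m1: "negligible {x \<in> A - S. \<bar>J x\<bar> * f (\<Phi> x) \<noteq> 0}"
    by (rule negligible_subset[OF negligible_Un[OF Dn bad]]) (auto simp: S_def)
  have m2: "negligible {x \<in> S - A. \<bar>J x\<bar> * f (\<Phi> x) \<noteq> 0}"
    by (rule negligible_subset[OF negligible_empty]) (auto simp: S_def)
  have absA: "(\<lambda>x. \<bar>J x\<bar> * f (\<Phi> x)) absolutely_integrable_on A"
    by (rule absolutely_integrable_spike_set[OF absS m2 m1])
  have intA: "integral A (\<lambda>x. \<bar>J x\<bar> * f (\<Phi> x)) = integral W f"
    using integral_spike_set[OF m2 m1] intS by simp
  have neg: "negligible (- D \<union> {x. x \<in> D \<and> J x < 0})" using Dn Jn by (rule negligible_Un)
  have eq: "f (\<Phi> x) * J x = \<bar>J x\<bar> * f (\<Phi> x)" if "x \<in> A - (- D \<union> {x. x \<in> D \<and> J x < 0})" for x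
    using that by (simp add: abs_if)
  have A': "(\<lambda>x. f (\<Phi> x) * J x) absolutely_integrable_on A"
    by (rule absolutely_integrable_spike[OF absA neg eq])
  have iA': "integral A (\<lambda>x. f (\<Phi> x) * J x) = integral W f"
    using integral_spike[OF neg eq] intA by simp
  show "set_integrable lebesgue (\<psi> -` A) f" using fW by (simp add: W_def)
  show "set_integrable lebesgue A (\<lambda>x. f (\<Phi> x) * det (jacobian \<Phi> (at x)))" using A' by (simp add: J_def)
  show "(LINT x:A|lebesgue. f (\<Phi> x) * det (jacobian \<Phi> (at x))) = (LINT y:\<psi> -` A|lebesgue. f y)"
    using set_lebesgue_integral_eq_integral(2)[OF A'] set_lebesgue_integral_eq_integral(2)[OF fW] iA'
    by (simp add: W_def J_def)
qed

subsection \<open>The flow\<close>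

text \<open>The homotopy along s is framed by two straight ones: from u to r u before it, and from
  \<open>h 0\<close> to \<open>f'\<close> after it. One radius r serves the whole sphere, small
  enough for the linearization error to stay within half the lower bound of
  \<open>f'\<close>.\<close>

lemma det_derivative_nonneg_of_isotopy:
  fixes F :: "real \<Rightarrow> real^'n::finite \<Rightarrow> real^'n"
  assumes "0 \<le> t" and F_t: "\<And>x. F t x = x"
    and cont: "continuous_on ({0..t} \<times> UNIV) (\<lambda>z. F (fst z) (snd z))"
    and contr: "\<And>s x y. s \<in> {0..t} \<Longrightarrow> norm (F 0 x - F 0 y) \<le> L * norm (F s x - F s y)"
    and der: "(F 0 has_derivative f') (at x0)"
  shows "0 \<le> det (matrix f')"
proof (cases "det (matrix f') = 0")
  case False
  have lin: "linear f'" using der by (rule has_derivative_linear)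
  have inj: "inj f'" using det_nz_iff_inj[OF lin] False by blast
  obtain c where c: "c > 0" "\<And>h. c * norm h \<le> norm (f' h)"
    using linear_inj_bounded_below_pos[OF lin inj] by (metis mult.commute)
  have "c / 2 > 0" using c by simp
  then obtain d where d: "d > 0" "\<And>y. norm (y - x0) < d \<Longrightarrow> norm (F 0 y - F 0 x0 - f' (y - x0)) \<le> c / 2 * norm (y - x0)"
    using der unfolding has_derivative_at_alt by blast
  define r where "r = d / 2"
  have r: "r > 0" "r < d" using d(1) by (auto simp: r_def)
  define h where "h s u = F s (x0 + r *\<^sub>R u) - F s x0" for s u
  have err: "norm (h 0 u - r *\<^sub>R f' u) \<le> c / 2 * r" if "norm u = 1" for u
    using d(2)[of "x0 + r *\<^sub>R u"] r that by (simp add: h_def linear_scale[OF lin])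
  \<comment> \<open>The difference \<open>h 0 u\<close> approximates
    \<open>r *\<^sub>R f' u\<close>, while the segment ends at \<open>f' u\<close> itself. If it met
    0, then \<open>((1 - v) * r + v) *\<^sub>R f' u\<close> would have norm at most
    \<open>(1 - v) * (c / 2 * r)\<close>; the lower bound c then forces both v and 1 - v to
    vanish.\<close>
  have segment: "(1 - v) *\<^sub>R h 0 u + v *\<^sub>R f' u \<noteq> 0" if u: "norm u = 1" and v: "0 \<le> v" "v \<le> 1" for u v
  proof
    assume "(1 - v) *\<^sub>R h 0 u + v *\<^sub>R f' u = 0"
    then have "((1 - v) * r + v) *\<^sub>R f' u = - ((1 - v) *\<^sub>R (h 0 u - r *\<^sub>R f' u))"
      by (simp add: algebra_simps)
    then have "norm (((1 - v) * r + v) *\<^sub>R f' u) = norm ((1 - v) *\<^sub>R (h 0 u - r *\<^sub>R f' u))"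
      by (metis norm_minus_cancel)
    then have "((1 - v) * r + v) * norm (f' u) = (1 - v) * norm (h 0 u - r *\<^sub>R f' u)"
      using v r by (simp add: abs_of_nonneg)
    moreover have "((1 - v) * r + v) * c \<le> ((1 - v) * r + v) * norm (f' u)"
      using c(2)[of u] u v r by (intro mult_left_mono) auto
    moreover have "(1 - v) * norm (h 0 u - r *\<^sub>R f' u) \<le> (1 - v) * (c / 2 * r)"
      using err[OF u] v by (intro mult_left_mono) auto
    ultimately have "(1 - v) * r * c + v * c \<le> ((1 - v) * r * c) / 2"
      by (simp add: algebra_simps)
    moreover have "(1 - v) * r * c \<ge> 0" "v * c \<ge> 0" using v r c by simp_all
    ultimately have "v * c = 0" "(1 - v) * r * c = 0" by linarith+
    then show False using r c by simp
  qed
  have h0: "h 0 u \<noteq> 0" if "norm u = 1" for u using segment[OF that, of 0] by simp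
  have 1: "homotopic_with_canon (\<lambda>_. True) (sphere 0 1) (UNIV - {0}) (\<lambda>u::real^'n. u) (\<lambda>u. r *\<^sub>R u)"
  proof (rule homotopic_with_linear)
    show "closed_segment u (r *\<^sub>R u) \<subseteq> UNIV - {0}" if "u \<in> sphere 0 1" for u :: "real^'n"
    proof -
      have "(1 - v) *\<^sub>R u + v *\<^sub>R r *\<^sub>R u \<noteq> 0" if v: "0 \<le> v" "v \<le> 1" for v
      proof -
        have "(1 - v) + v * r > 0"
          using v r by (cases "v = 1") (auto intro: add_pos_nonneg)
        moreover have "u \<noteq> 0" using \<open>u \<in> sphere 0 1\<close> by auto
        ultimately have "((1 - v) + v * r) *\<^sub>R u \<noteq> 0" by simp
        then show ?thesis by (simp only: scaleR_add_left scaleR_scaleR) simp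
      qed
      then show ?thesis by (auto simp: closed_segment_def)
    qed
  qed (auto intro!: continuous_intros)
  have 2: "homotopic_with_canon (\<lambda>_. True) (sphere 0 1) (UNIV - {0}) (\<lambda>u. r *\<^sub>R u) (h 0)"
  proof (rule homotopic_with_canonI[where H="\<lambda>v. h ((1 - v) * t)"])
    have seg: "(1 - v) * t \<in> {0..t}" if "0 \<le> v" "v \<le> 1" for v
      using that \<open>0 \<le> t\<close> by (auto simp: mult_left_le_one_le)
    show "continuous_on ({0..1} \<times> sphere 0 1) (\<lambda>z. h ((1 - fst z) * t) (snd z))"
      unfolding h_def
      by (intro continuous_intros continuous_on_compose2[OF cont, of _ "\<lambda>z. ((1 - fst z) * t, x0 + r *\<^sub>R snd z)", simplified]
          continuous_on_compose2[OF cont, of _ "\<lambda>z. ((1 - fst z) * t, x0)", simplified])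
         (use seg in auto)
    show "h ((1 - v) * t) u \<in> UNIV - {0}" if "0 \<le> v" "v \<le> 1" "u \<in> sphere 0 1" for v u
    proof -
      have "norm (h 0 u) \<le> L * norm (h ((1 - v) * t) u)"
        unfolding h_def by (rule contr[OF seg[OF that(1,2)]])
      then show ?thesis using h0[of u] that(3) by auto
    qed
  qed (simp_all add: h_def F_t)
  have 3: "homotopic_with_canon (\<lambda>_. True) (sphere 0 1) (UNIV - {0}) (h 0) f'"
  proof (rule homotopic_with_linear)
    show "continuous_on (sphere 0 1) (h 0)"
      unfolding h_def using \<open>0 \<le> t\<close>
      by (intro continuous_intros continuous_on_compose2[OF cont, of _ "\<lambda>u. (0, x0 + r *\<^sub>R u)", simplified]) auto
    show "continuous_on (sphere 0 1) f'"
      by (intro linear_continuous_on) (use lin in \<open>simp add: linear_conv_bounded_linear\<close>)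
    show "closed_segment (h 0 u) (f' u) \<subseteq> UNIV - {0}" if "u \<in> sphere 0 1" for u
      using segment[of u] that by (auto simp: closed_segment_def)
  qed
  show ?thesis
    using det_pos_if_homotopic_id[OF lin inj homotopic_with_trans[OF 1 homotopic_with_trans[OF 2 3]]] by simp
qed simp

text \<open>For finite exponent q, \<bar>f\<bar> is at most 1 plus its q-th power, and a compact set
  has finite measure.\<close>

lemma Lp_loc_imp_locally_integrable:
  assumes "Lp_loc p f" "1 \<le> p" "compact K"
  shows "set_integrable lebesgue K f"
proof -
  have fm [measurable]: "f \<in> borel_measurable lebesgue" using assms(1) by (simp add: Lp_loc_def)
  have Km [measurable]: "K \<in> sets lebesgue" and Kf: "emeasure lebesgue K < \<infinity>"
    using lmeasurable_compact[OF assms(3)] by (auto simp: fmeasurable_def)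
  have const: "integrable lebesgue (\<lambda>x. indicator K x * M)" for M :: real
    using Kf by (intro integrable_mult_left integrable_real_indicator) auto
  show ?thesis
    unfolding set_integrable_def
  proof (cases "p = \<infinity>")
    case True
    then obtain M where M: "AE x in lebesgue. x \<in> K \<longrightarrow> \<bar>f x\<bar> \<le> M"
      using assms by (auto simp: Lp_loc_def)
    show "integrable lebesgue (\<lambda>x. indicator K x *\<^sub>R f x)"
    proof (rule Bochner_Integration.integrable_bound[OF const[of M]])
      show "AE x in lebesgue. norm (indicator K x *\<^sub>R f x) \<le> norm (indicator K x * M)"
        using M by eventually_elim (auto simp: indicator_def)
    qed measurable
  next
    case False
    define q where "q = enn2real p"
    have "q \<ge> 1" using assms(2) False enn2real_mono[of 1 p] by (simp add: q_def top.not_eq_extremum)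
    have "set_integrable lebesgue K (\<lambda>x. \<bar>f x\<bar> powr q)"
      using assms False by (simp add: Lp_loc_def q_def)
    then have "integrable lebesgue (\<lambda>x. indicator K x * 1 + indicator K x *\<^sub>R \<bar>f x\<bar> powr q)"
      unfolding set_integrable_def by (rule Bochner_Integration.integrable_add[OF const])
    then show "integrable lebesgue (\<lambda>x. indicator K x *\<^sub>R f x)"
    proof (rule Bochner_Integration.integrable_bound)
      have "\<bar>f x\<bar> \<le> 1 + \<bar>f x\<bar> powr q" for x
      proof (cases "\<bar>f x\<bar> \<le> 1")
        case False
        then have "\<bar>f x\<bar> powr 1 \<le> \<bar>f x\<bar> powr q" using \<open>q \<ge> 1\<close> by (intro powr_mono) auto
        then show ?thesis using False by simp
      qed (simp add: add_increasing2)
      then show "AE x in lebesgue. norm (indicator K x *\<^sub>R f x)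
          \<le> norm (indicator K x * 1 + indicator K x *\<^sub>R \<bar>f x\<bar> powr q)"
        by (intro AE_I2) (auto simp: indicator_def abs_of_nonneg)
    qed measurable
  qed
qed

text \<open>With s = t this is the Lipschitz bound for the flow; with r = 0 it says that
  trajectories which meet at time s coincide at time 0.\<close>

lemma backward_flow_contraction:
  fixes b :: "real \<Rightarrow> 'a::real_inner \<Rightarrow> 'a"
  assumes C: "set_integrable lebesgue {0..T} C" "\<And>t. t \<in> {0..T} \<Longrightarrow> C t \<ge> 0"
    and osl: "\<And>t x y. t \<in> {0..T} \<Longrightarrow> (b t x - b t y) \<bullet> (x - y) \<ge> - C t * (norm (x - y))\<^sup>2"
    and flow: "backward_flow T b \<phi>"
    and t: "0 \<le> r" "r \<le> s" "s \<le> t" "t \<le> T"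
  shows "norm (\<phi> r t x - \<phi> r t y) \<le> exp (integral {0..t} C) * norm (\<phi> s t x - \<phi> s t y)"
proof (rule one_sided_Gronwall[OF t(1-3)])
  have traj: "backward_filippov_trajectory b t x (\<lambda>s. \<phi> s t x)" for x
    using flow t by (simp add: backward_flow_def)
  show "abs_continuous_curve 0 t (\<lambda>s. \<phi> s t x)" "abs_continuous_curve 0 t (\<lambda>s. \<phi> s t y)"
    using traj by (simp_all add: backward_filippov_trajectory_def)
  have "C integrable_on {0..T}" using set_lebesgue_integral_eq_integral(1)[OF C(1)] .
  then show "C integrable_on {0..t}" by (rule integrable_subinterval_real) (use t in auto)
  show "C u \<ge> 0" if "u \<in> {0..t}" for u using C(2) that t by auto
  have der: "AE u in lebesgue. u \<in> {0..t} \<longrightarrow>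
        (\<exists>v \<in> filippov_hull b u (\<phi> u t x). ((\<lambda>s. \<phi> s t x) has_vector_derivative v) (at u within {0..t}))" for x
    using traj[of x] by (simp add: backward_filippov_trajectory_def)
  show "AE u in lebesgue. u \<in> {0..t} \<longrightarrow> (\<exists>v w. ((\<lambda>s. \<phi> s t x) has_vector_derivative v) (at u within {0..t}) \<and>
       ((\<lambda>s. \<phi> s t y) has_vector_derivative w) (at u within {0..t}) \<and>
       (v - w) \<bullet> (\<phi> u t x - \<phi> u t y) \<ge> - C u * (norm (\<phi> u t x - \<phi> u t y))\<^sup>2)"
    using der[of x] der[of y]
  proof eventually_elim
    case (elim u)
    show ?case
    proof
      assume u: "u \<in> {0..t}"
      then have "u \<in> {0..T}" using t by auto
      from u elim obtain v w where "v \<in> filippov_hull b u (\<phi> u t x)" "w \<in> filippov_hull b u (\<phi> u t y)"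
        and der: "((\<lambda>s. \<phi> s t x) has_vector_derivative v) (at u within {0..t})"
          "((\<lambda>s. \<phi> s t y) has_vector_derivative w) (at u within {0..t})" by blast
      from filippov_hull_one_sided_Lipschitz[OF osl[OF \<open>u \<in> {0..T}\<close>] this(1,2)] der
      show "\<exists>v w. ((\<lambda>s. \<phi> s t x) has_vector_derivative v) (at u within {0..t}) \<and>
       ((\<lambda>s. \<phi> s t y) has_vector_derivative w) (at u within {0..t}) \<and>
       (v - w) \<bullet> (\<phi> u t x - \<phi> u t y) \<ge> - C u * (norm (\<phi> u t x - \<phi> u t y))\<^sup>2" by blast
    qed
  qed
qed

text \<open>Supplies the joint continuity that a homotopy needs: the Lipschitz constant in x is
  uniform in s, so continuity in s at a fixed x is enough.\<close>

lemma continuous_on_Times_Lipschitz: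
  fixes F :: "'a::metric_space \<Rightarrow> 'b::real_normed_vector \<Rightarrow> 'c::real_normed_vector"
  assumes cont: "\<And>x. continuous_on S (\<lambda>s. F s x)"
    and Lip: "\<And>s x y. s \<in> S \<Longrightarrow> norm (F s x - F s y) \<le> L * norm (x - y)"
  shows "continuous_on (S \<times> UNIV) (\<lambda>z. F (fst z) (snd z))"
  unfolding continuous_on_def
proof
  fix z0 :: "'a \<times> 'b" assume z0: "z0 \<in> S \<times> UNIV"
  obtain s0 x0 where z: "z0 = (s0, x0)" by (cases z0)
  let ?F = "at z0 within S \<times> UNIV"
  have "((\<lambda>z. F (fst z) x0) \<longlongrightarrow> F (fst z0) x0) ?F"
  proof -
    have "continuous_on (S \<times> UNIV) (\<lambda>z. F (fst z) x0)"
      by (rule continuous_on_compose2[OF cont[of x0]]) (auto intro!: continuous_intros)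
    then show ?thesis using z0 unfolding continuous_on_def by blast
  qed
  moreover have "((\<lambda>z. F (fst z) (snd z) - F (fst z) x0) \<longlongrightarrow> 0) ?F"
  proof (rule Lim_null_comparison)
    show "\<forall>\<^sub>F z in ?F. norm (F (fst z) (snd z) - F (fst z) x0) \<le> L * norm (snd z - x0)"
      unfolding eventually_at_filter by (rule always_eventually) (auto intro: Lip)
    have "((\<lambda>z. L * norm (snd z - x0)) \<longlongrightarrow> L * norm (snd z0 - x0)) ?F"
      by (intro tendsto_intros)
    then show "((\<lambda>z. L * norm (snd z - x0)) \<longlongrightarrow> 0) ?F" by (simp add: z)
  qed
  ultimately show "((\<lambda>z. F (fst z) (snd z)) \<longlongrightarrow> F (fst z0) (snd z0)) ?F"
    using tendsto_add[of "\<lambda>z. F (fst z) x0" "F (fst z0) x0" ?F "\<lambda>z. F (fst z) (snd z) - F (fst z) x0" 0]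
    by (simp add: z)
qed

theorem corollary4p2:
  fixes T :: real
    and b :: "real \<Rightarrow> real^'n::{finite,wellorder} \<Rightarrow> real^'n::_"
    and C\<^sub>0 C\<^sub>1 :: "real \<Rightarrow> real"
    and \<phi> \<psi> :: "real \<Rightarrow> real \<Rightarrow> real^'n::_ \<Rightarrow> real^'n::_"
    and p :: ennreal
    and f\<^sub>0 :: "real^'n::_ \<Rightarrow> real"
  assumes "T > 0"
    and "(\<lambda>(t, x). b t x) \<in> borel_measurable (lebesgue_on ({0..T} \<times> UNIV))"
    and "set_integrable lebesgue {0..T} C\<^sub>0" and "\<And>t. t \<in> {0..T} \<Longrightarrow> C\<^sub>0 t \<ge> 0"
    and "set_integrable lebesgue {0..T} C\<^sub>1" and "\<And>t. t \<in> {0..T} \<Longrightarrow> C\<^sub>1 t \<ge> 0"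
    and "\<And>t x. t \<in> {0..T} \<Longrightarrow> norm (b t x) \<le> C\<^sub>0 t * (1 + norm x)"
    and "\<And>t x y. t \<in> {0..T} \<Longrightarrow> (b t x - b t y) \<bullet> (x - y) \<ge> - C\<^sub>1 t * (norm (x - y))\<^sup>2"
    and "backward_flow T b \<phi>"
    and "forward_flow T \<phi> \<psi>"
    and "1 \<le> p" and "Lp_loc p f\<^sub>0"
  shows "\<forall>t\<in>{0<..T}. pushforward_density (\<psi> t 0) f\<^sub>0 (good_solution \<phi> f\<^sub>0 t)"
proof
  fix t assume "t \<in> {0<..T}"
  then have t: "0 \<le> t" "t \<le> T" by auto
  define L where "L = exp (integral {0..t} C\<^sub>1)"
  have contr: "norm (\<phi> r t x - \<phi> r t y) \<le> L * norm (\<phi> s t x - \<phi> s t y)"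
    if "0 \<le> r" "r \<le> s" "s \<le> t" for r s x y
    unfolding L_def by (rule backward_flow_contraction[OF assms(5,6,8,9) that t(2)])
  have traj: "backward_filippov_trajectory b t x (\<lambda>s. \<phi> s t x)" for x
    using assms(9) t by (simp add: backward_flow_def)
  have \<phi>tt: "\<phi> t t x = x" for x
    using traj[of x] by (simp add: backward_filippov_trajectory_def)
  \<comment> \<open>The later time in the estimate is t itself, where the flow is the
    identity.\<close>
  have Lip: "norm (\<phi> s t x - \<phi> s t y) \<le> L * norm (x - y)" if "s \<in> {0..t}" for s x y
    using contr[of s t x y] that by (simp add: \<phi>tt)
  have cont: "continuous_on ({0..t} \<times> UNIV) (\<lambda>z. \<phi> (fst z) t (snd z))"
  proof (rule continuous_on_Times_Lipschitz[where F="\<lambda>s. \<phi> s t", OF _ Lip])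
    show "continuous_on {0..t} (\<lambda>s. \<phi> s t x)" for x
      using traj[of x] by (intro abs_continuous_curve_imp_continuous_on) (simp add: backward_filippov_trajectory_def)
  qed
  have lip: "L-lipschitz_on UNIV (\<phi> 0 t)"
    using Lip[of 0] t by (intro lipschitz_onI) (auto simp: dist_norm L_def)
  have diff: "AE x in lebesgue. \<phi> 0 t differentiable at x"
    using lip by (rule Rademacher)
  have pos: "det (jacobian (\<phi> 0 t) (at x)) \<ge> 0" if "\<phi> 0 t differentiable at x" for x
    unfolding jacobian_def
  proof (rule det_derivative_nonneg_of_isotopy[where F="\<lambda>s. \<phi> s t", OF t(1) \<phi>tt cont])
    show "norm (\<phi> 0 t x - \<phi> 0 t y) \<le> L * norm (\<phi> s t x - \<phi> s t y)" if "s \<in> {0..t}" for s x y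
      using contr[of 0 s x y] that by simp
    show "(\<phi> 0 t has_derivative frechet_derivative (\<phi> 0 t) (at x)) (at x)"
      using that frechet_derivative_works by blast
  qed
  have fib: "AE y in lebesgue. \<phi> 0 t -` {y} = {\<psi> t 0 y}" and "AE y in lebesgue. isCont (\<psi> t 0) y"
    using assms(10) t by (auto simp: forward_flow_def)
  then have \<psi>: "\<psi> t 0 \<in> lebesgue \<rightarrow>\<^sub>M borel" by (intro AE_continuous_lebesgue_measurable)
  have f: "set_integrable lebesgue K f\<^sub>0" if "compact K" for K
    using Lp_loc_imp_locally_integrable[OF assms(12,11) that] .
  have good: "good_solution \<phi> f\<^sub>0 t = (\<lambda>x. f\<^sub>0 (\<phi> 0 t x) * det (jacobian (\<phi> 0 t) (at x)))"
    by (simp add: fun_eq_iff good_solution_def flow_jacobian_def)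
  show "pushforward_density (\<psi> t 0) f\<^sub>0 (good_solution \<phi> f\<^sub>0 t)"
    unfolding pushforward_density_def good
    using Lipschitz_pushforward_of_right_inverse[OF lip diff _ fib \<psi> f] pos \<psi> by simp
qed

end
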